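(* Let $0<\alpha\le1$ and $1<p<\infty$. The space $W_{\Delta,b^-}^{\alpha,p}$ is reflexive with respect to the norm $\|\cdot\|_{W_{\Delta,b^-}^{\alpha,p}}$ given by $\|u\|_{W_{\Delta,b^-}^{\alpha,p}}^p=\|u\|_{L_\Delta^p}^p+\|{}_t^{\mathbb T}D_b^\alpha u\|_{L_\Delta^p}^p$.
   Context: Setting: $\mathbb T$ is a time scale (a nonempty closed subset of $\mathbb R$), $a,b\in\mathbb T$ with $0<a<b$, $J=[a,b]\cap\mathbb T$, $J^0=[a,b)\cap\mathbb T$, $N\in\mathbb{N}$. $\sigma(t)=\inf\{s\in\mathbb T:s>t\}$ is the forward jump operator (with $\inf\varnothing=\sup\mathbb T$), $f^\Delta$ is the delta (Hilger) derivative, and $\int\cdot\,\Delta s$ is the (Lebesgue) delta integral ($\int_c^d$ is over $[c,d)\cap\mathbb T$). $L_\Delta^p=L_\Delta^p(J^0,\mathbb R^N)$ with norm $\|f\|_{L_\Delta^p}=\left(\int_a^b|f(s)|^p\Delta s\right)^{1/p}$. Fractional operators (componentwise), $0<\alpha\le1$: $${}_a^{\mathbb T}I_t^\alpha h(t)=\int_a^t\frac{(t-\sigma(s))^{\alpha-1}}{\Gamma(\alpha)}h(s)\Delta s,\qquad {}_t^{\mathbb T}I_b^\alpha h(t)=\int_t^b\frac{(s-\sigma(t))^{\alpha-1}}{\Gamma(\alpha)}h(s)\Delta s,$$ $I^0$ is the identity, ${}_a^{\mathbb T}D_t^\alpha h=\left({}_a^{\mathbb T}I_t^{1-\alpha}h\right)^\Delta$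 and ${}_t^{\mathbb T}D_b^\alpha h=-\left({}_t^{\mathbb T}I_b^{1-\alpha}h\right)^\Delta$ (left and right Riemann–Liouville derivatives). $W_{\Delta,b^-}^{\alpha,p}$ is the set of all $u\in L_\Delta^p$ for which there exists $g\in L_\Delta^p$ (the weak right fractional derivative) such that $\int_a^b u\cdot{}_a^{\mathbb T}D_t^\alpha\varphi\,\Delta t=\int_a^b g\cdot\varphi\,\Delta t$ for all $\varphi\in C_{c,rd}^\infty$, where $C_{c,rd}^\infty$ denotes the $\mathbb R^N$-valued functions on $J$ that are infinitely often delta differentiable with rd-continuous derivatives and have compact support in $(a,b)\cap\mathbb T$. For $u\in W_{\Delta,b^-}^{\alpha,p}$, ${}_t^{\mathbb T}D_b^\alpha u$ exists $\Delta$-a.e., equals $g$, and lies in $L_\Delta^p$.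
   Formalization: Only test functions whose left derivative exists a.e. and lies in L^q, q=p/(p-1), are used; the norm is the infimum over weak derivatives g; for the pointwise derivative, the stated fact that it exists a.e. and equals g is a hypothesis, since it and the definition fail on some time scales. *)

theory Defs
  imports "HOL-Analysis.Analysis"
begin

section \<open>Normed spaces on a carrier set, and reflexivity\<close>

text \<open>
  The spaces below depend on a time scale, an interval and two exponents, so they cannot be types.
  Normed spaces are therefore records with an explicit carrier. Duals are again such records, their
  points being extensional functions, so that equal functionals are equal objects.
\<close>

record 'v nspace =
  pts :: "'v set"
  vzero :: 'v
  vadd :: "'v \<Rightarrow> 'v \<Rightarrow> 'v"
  vscale :: "real \<Rightarrow> 'v \<Rightarrow> 'v"
  vnorm :: "'v \<Rightarrow> real"

locale real_nspace =
  fixes X :: "'v nspace"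
  assumes zero_closed: "vzero X \<in> pts X"
    and add_closed: "x \<in> pts X \<Longrightarrow> y \<in> pts X \<Longrightarrow> vadd X x y \<in> pts X"
    and scale_closed: "x \<in> pts X \<Longrightarrow> vscale X c x \<in> pts X"
    and add_assoc: "x \<in> pts X \<Longrightarrow> y \<in> pts X \<Longrightarrow> z \<in> pts X \<Longrightarrow>
          vadd X (vadd X x y) z = vadd X x (vadd X y z)"
    and add_commute: "x \<in> pts X \<Longrightarrow> y \<in> pts X \<Longrightarrow> vadd X x y = vadd X y x"
    and add_zero: "x \<in> pts X \<Longrightarrow> vadd X x (vzero X) = x"
    and add_inverse: "x \<in> pts X \<Longrightarrow> vadd X x (vscale X (- 1) x) = vzero X"
    and scale_add_right: "x \<in> pts X \<Longrightarrow> y \<in> pts X \<Longrightarrow>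
          vscale X c (vadd X x y) = vadd X (vscale X c x) (vscale X c y)"
    and scale_add_left: "x \<in> pts X \<Longrightarrow>
          vscale X (c + d) x = vadd X (vscale X c x) (vscale X d x)"
    and scale_scale: "x \<in> pts X \<Longrightarrow> vscale X c (vscale X d x) = vscale X (c * d) x"
    and scale_one: "x \<in> pts X \<Longrightarrow> vscale X 1 x = x"
    and norm_nonneg: "x \<in> pts X \<Longrightarrow> 0 \<le> vnorm X x"
    and norm_eq_zero_iff: "x \<in> pts X \<Longrightarrow> vnorm X x = 0 \<longleftrightarrow> x = vzero X"
    and norm_scale: "x \<in> pts X \<Longrightarrow> vnorm X (vscale X c x) = \<bar>c\<bar> * vnorm X x"
    and norm_triangle: "x \<in> pts X \<Longrightarrow> y \<in> pts X \<Longrightarrow>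
          vnorm X (vadd X x y) \<le> vnorm X x + vnorm X y"

definition dual :: "'v nspace \<Rightarrow> ('v \<Rightarrow> real) nspace" where
  "dual X =
    \<lparr>pts = {f \<in> extensional (pts X).
              (\<forall>x\<in>pts X. \<forall>y\<in>pts X. f (vadd X x y) = f x + f y) \<and>
              (\<forall>c. \<forall>x\<in>pts X. f (vscale X c x) = c * f x) \<and>
              (\<exists>K. \<forall>x\<in>pts X. \<bar>f x\<bar> \<le> K * vnorm X x)},
     vzero = (\<lambda>x\<in>pts X. 0),
     vadd = (\<lambda>f g. \<lambda>x\<in>pts X. f x + g x),
     vscale = (\<lambda>c f. \<lambda>x\<in>pts X. c * f x),
     vnorm = (\<lambda>f. Sup {\<bar>f x\<bar> | x. x \<in> pts X \<and> vnorm X x \<le> 1})\<rparr>"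

definition bidual_embedding :: "'v nspace \<Rightarrow> 'v \<Rightarrow> (('v \<Rightarrow> real) \<Rightarrow> real)" where
  "bidual_embedding X x = (\<lambda>f\<in>pts (dual X). f x)"

definition reflexive :: "'v nspace \<Rightarrow> bool" where
  "reflexive X \<longleftrightarrow>
     real_nspace X \<and> bidual_embedding X ` pts X = pts (dual (dual X))"

section \<open>Calculus on time scales\<close>

definition time_scale :: "real set \<Rightarrow> bool" where
  "time_scale T \<longleftrightarrow> closed T \<and> T \<noteq> {}"

definition fwd_jump :: "real set \<Rightarrow> real \<Rightarrow> real" where
  "fwd_jump T t = (if \<exists>s\<in>T. t < s then Inf {s \<in> T. t < s} else Sup T)"

definition bwd_jump :: "real set \<Rightarrow> real \<Rightarrow> real" where
  "bwd_jump T t = (if \<exists>s\<in>T. s < t then Sup {s \<in> T. s < t} else Inf T)"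

text \<open>\<open>kappa T\<close> is the set of points at which a function on \<open>T\<close> is differentiated: a left-scattered
  maximum of \<open>T\<close> is removed.\<close>

definition kappa :: "real set \<Rightarrow> real set" where
  "kappa T = (if bdd_above T then T - {bwd_jump T (Sup T)<..Sup T} else T)"

definition has_delta_deriv ::
    "real set \<Rightarrow> (real \<Rightarrow> 'c::real_normed_vector) \<Rightarrow> real \<Rightarrow> 'c \<Rightarrow> bool" where
  "has_delta_deriv T f t d \<longleftrightarrow>
     (\<forall>\<epsilon>>0. \<exists>\<delta>>0. \<forall>s\<in>T. \<bar>s - t\<bar> < \<delta> \<longrightarrow>
        norm (f (fwd_jump T t) - f s - (fwd_jump T t - s) *\<^sub>R d) \<le> \<epsilon> * \<bar>fwd_jump T t - s\<bar>)"

definition rd_continuous :: "real set \<Rightarrow> (real \<Rightarrow> 'c::real_normed_vector) \<Rightarrow> bool" where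
  "rd_continuous T f \<longleftrightarrow>
     (\<forall>t\<in>T. (\<exists>s\<in>T. t < s) \<and> fwd_jump T t = t \<longrightarrow> continuous (at t within T) f) \<and>
     (\<forall>t\<in>T. (\<exists>s\<in>T. s < t) \<and> bwd_jump T t = t \<longrightarrow>
        (\<exists>l. (f \<longlongrightarrow> l) (at t within T \<inter> {..<t})))"

abbreviation ts_interval :: "real set \<Rightarrow> real \<Rightarrow> real \<Rightarrow> real set" where
  "ts_interval T a b \<equiv> T \<inter> {a..b}"

text \<open>\<open>F n\<close> is the \<open>n\<close>-th delta derivative of \<open>\<phi>\<close>; it lives on the \<open>n\<close>-fold iterate of \<open>kappa\<close>.\<close>

definition test_function ::
    "real set \<Rightarrow> real \<Rightarrow> real \<Rightarrow> (real \<Rightarrow> 'c::real_normed_vector) \<Rightarrow> bool" where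
  "test_function T a b \<phi> \<longleftrightarrow>
     (\<exists>F. F 0 = \<phi> \<and>
        (\<forall>n. rd_continuous ((kappa ^^ n) (ts_interval T a b)) (F n) \<and>
             (\<forall>t\<in>(kappa ^^ Suc n) (ts_interval T a b).
                has_delta_deriv ((kappa ^^ n) (ts_interval T a b)) (F n) t (F (Suc n) t)))) \<and>
     (\<exists>K. compact K \<and> K \<subseteq> T \<inter> {a<..<b} \<and> (\<forall>t\<in>ts_interval T a b - K. \<phi> t = 0))"

text \<open>The Lebesgue delta measure on \<open>[a,b) \<inter> T\<close>: the completion of the measure that gives
  \<open>[c,d) \<inter> T\<close> the mass \<open>d - c\<close>.\<close>

definition delta_borel :: "real set \<Rightarrow> real \<Rightarrow> real \<Rightarrow> real measure" where
  "delta_borel T a b =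
     extend_measure (T \<inter> {a..<b}) {(c, d). c \<in> ts_interval T a b \<and> d \<in> ts_interval T a b \<and> c \<le> d}
       (\<lambda>(c, d). T \<inter> {c..<d}) (\<lambda>(c, d). ennreal (d - c))"

definition delta_measure :: "real set \<Rightarrow> real \<Rightarrow> real \<Rightarrow> real measure" where
  "delta_measure T a b = completion (delta_borel T a b)"

text \<open>Such a measure exists (the image of Lebesgue measure under rounding down to \<open>T\<close>), so the
  degenerate branch of \<^const>\<open>extend_measure\<close> is not taken.\<close>

lemma emeasure_delta_borel:
  assumes T: "closed T" and ab: "a \<in> T" "b \<in> T"
    and cd: "c \<in> ts_interval T a b" "d \<in> ts_interval T a b" "c \<le> d"
  shows "emeasure (delta_borel T a b) (T \<inter> {c..<d}) = ennreal (d - c)"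
proof -
  define I where "I = {(c, d). c \<in> ts_interval T a b \<and> d \<in> ts_interval T a b \<and> c \<le> d}"
  define G where "G = (\<lambda>(c, d). T \<inter> {c..<d})"
  define r where "r x = Sup {s \<in> T. s \<le> x}" for x
  define L where "L = restrict_space lborel {a..<b}"
  define S where "S = sigma (T \<inter> {a..<b}) (G ` I)"
  have GI: "G ` I \<subseteq> Pow (T \<inter> {a..<b})"
    by (auto simp: G_def I_def)
  have rT: "r x \<in> T" "r x \<le> x" if "a \<le> x" for x
  proof -
    have ne: "{s \<in> T. s \<le> x} \<noteq> {}" using ab that by auto
    have bd: "bdd_above {s \<in> T. s \<le> x}" by (auto intro: bdd_aboveI[of _ x])
    have "closed {s \<in> T. s \<le> x}"
      using T closed_Int[of T "{..x}"] by (simp add: Int_def)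
    from closed_contains_Sup[OF ne bd this] show "r x \<in> T" "r x \<le> x"
      by (auto simp: r_def)
  qed
  have r_upper: "s \<le> r x" if "s \<in> T" "s \<le> x" for s x
    unfolding r_def using that by (intro cSup_upper) (auto intro: bdd_aboveI[of _ x])
  have pre: "r -` (T \<inter> {c..<d}) \<inter> {a..<b} = {c..<d}"
    if c: "c \<in> ts_interval T a b" and d: "d \<in> ts_interval T a b" for c d
  proof -
    have "c \<le> r x \<longleftrightarrow> c \<le> x" "r x < d \<longleftrightarrow> x < d" "r x \<in> T" if "a \<le> x" for x
      using rT[OF that] r_upper[of c x] r_upper[of d x] c d
      by (auto intro: order_trans, meson not_le)
    then show ?thesis
      using c d by (auto simp: vimage_def)
  qed
  have r_meas: "r \<in> measurable L S"
    unfolding S_def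
  proof (rule measurable_measure_of)
    show "r \<in> space L \<rightarrow> T \<inter> {a..<b}"
      using rT r_upper[OF ab(1)] by (force simp: L_def space_restrict_space)
    show "r -` A \<inter> space L \<in> sets L" if A: "A \<in> G ` I" for A
    proof -
      obtain c d where *: "A = T \<inter> {c..<d}" "c \<in> ts_interval T a b" "d \<in> ts_interval T a b"
        using A by (auto simp: G_def I_def)
      have "{c..<d} \<in> sets L" using *
        by (auto simp: L_def sets_restrict_space_iff)
      then show ?thesis using pre[OF *(2,3)] * by (simp add: L_def space_restrict_space)
    qed
  qed (use GI in auto)
  have eq: "emeasure (distr L S r) (G i) = (case i of (c, d) \<Rightarrow> ennreal (d - c))" if iI: "i \<in> I" for i
  proof -
    obtain c d where i: "i = (c, d)" "c \<in> ts_interval T a b" "d \<in> ts_interval T a b" "c \<le> d"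
      using iI by (auto simp: I_def)
    have "G i \<in> sets S" using iI GI by (auto simp: S_def)
    then have "emeasure (distr L S r) (G i) = emeasure L (r -` G i \<inter> space L)"
      by (rule emeasure_distr[OF r_meas])
    also have "r -` G i \<inter> space L = {c..<d}"
      using pre[OF i(2,3)] i by (simp add: G_def L_def space_restrict_space)
    also have "emeasure L {c..<d} = emeasure lborel {c..<d}"
      unfolding L_def
      using i by (intro emeasure_restrict_space) auto
    finally show ?thesis using i by simp
  qed
  have ext: "delta_borel T a b =
      extend_measure (T \<inter> {a..<b}) I G (\<lambda>(c, d). ennreal (d - c))"
    unfolding delta_borel_def I_def G_def ..
  have sets: "sets (delta_borel T a b) = sets (distr L S r)"
    unfolding ext sets_extend_measure[OF GI] sets_distr S_def using GI by simp
  have "emeasure (delta_borel T a b) (G (c, d)) = (case (c, d) of (c, d) \<Rightarrow> ennreal (d - c))"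
  proof (rule emeasure_extend_measure[OF ext eq GI])
    show "positive (sets (delta_borel T a b)) (emeasure (distr L S r))"
      "countably_additive (sets (delta_borel T a b)) (emeasure (distr L S r))"
      unfolding sets by (rule emeasure_positive emeasure_countably_additive)+
    show "(c, d) \<in> I" using cd by (auto simp: I_def)
  qed
  then show ?thesis by (simp add: G_def)
qed

section \<open>\<open>L\<^sup>p\<close> functions and fractional operators\<close>

definition lp_functions ::
    "real set \<Rightarrow> real \<Rightarrow> real \<Rightarrow> real \<Rightarrow> (real \<Rightarrow> 'c::euclidean_space) set" where
  "lp_functions T a b p =
     {f \<in> borel_measurable (delta_measure T a b).
        integrable (delta_measure T a b) (\<lambda>t. norm (f t) powr p)}"

definition lp_norm ::
    "real set \<Rightarrow> real \<Rightarrow> real \<Rightarrow> real \<Rightarrow> (real \<Rightarrow> 'c::euclidean_space) \<Rightarrow> real" where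
  "lp_norm T a b p f = (LINT t|delta_measure T a b. norm (f t) powr p) powr (1 / p)"

definition ae_class ::
    "real set \<Rightarrow> real \<Rightarrow> real \<Rightarrow> real \<Rightarrow> (real \<Rightarrow> 'c::euclidean_space) \<Rightarrow> (real \<Rightarrow> 'c) set" where
  "ae_class T a b p u =
     {v \<in> lp_functions T a b p. AE t in delta_measure T a b. v t = u t}"

text \<open>
  The kernels of order \<open>\<beta> > 0\<close>, up to the factor \<open>1 / Gamma \<beta>\<close>. On a time scale with scattered
  points the base can vanish (left kernel, \<open>\<sigma>(s) = t\<close>) or be negative (right kernel, \<open>s = t\<close>
  right-scattered). Then \<^const>\<open>powr\<close> applies: \<open>0 powr r = 0\<close> and
  \<open>(- x) powr r = x powr r\<close>.
\<close>

definition left_integrand ::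
    "real set \<Rightarrow> real \<Rightarrow> (real \<Rightarrow> 'c::euclidean_space) \<Rightarrow> real \<Rightarrow> real \<Rightarrow> 'c" where
  "left_integrand T \<beta> h t s = ((t - fwd_jump T s) powr (\<beta> - 1) / Gamma \<beta>) *\<^sub>R h s"

definition right_integrand ::
    "real set \<Rightarrow> real \<Rightarrow> (real \<Rightarrow> 'c::euclidean_space) \<Rightarrow> real \<Rightarrow> real \<Rightarrow> 'c" where
  "right_integrand T \<beta> h t s = ((s - fwd_jump T t) powr (\<beta> - 1) / Gamma \<beta>) *\<^sub>R h s"

definition left_int_exists ::
    "real set \<Rightarrow> real \<Rightarrow> real \<Rightarrow> real \<Rightarrow> (real \<Rightarrow> 'c::euclidean_space) \<Rightarrow> real \<Rightarrow> bool" where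
  "left_int_exists T a b \<beta> h t \<longleftrightarrow>
     \<beta> = 0 \<or> set_integrable (delta_measure T a b) {a..<t} (left_integrand (ts_interval T a b) \<beta> h t)"

definition right_int_exists ::
    "real set \<Rightarrow> real \<Rightarrow> real \<Rightarrow> real \<Rightarrow> (real \<Rightarrow> 'c::euclidean_space) \<Rightarrow> real \<Rightarrow> bool" where
  "right_int_exists T a b \<beta> h t \<longleftrightarrow>
     \<beta> = 0 \<or> set_integrable (delta_measure T a b) {t..<b} (right_integrand (ts_interval T a b) \<beta> h t)"

definition left_int ::
    "real set \<Rightarrow> real \<Rightarrow> real \<Rightarrow> real \<Rightarrow> (real \<Rightarrow> 'c::euclidean_space) \<Rightarrow> real \<Rightarrow> 'c" where
  "left_int T a b \<beta> h t =
     (if \<beta> = 0 then h t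
      else LINT s:{a..<t}|delta_measure T a b. left_integrand (ts_interval T a b) \<beta> h t s)"

definition right_int ::
    "real set \<Rightarrow> real \<Rightarrow> real \<Rightarrow> real \<Rightarrow> (real \<Rightarrow> 'c::euclidean_space) \<Rightarrow> real \<Rightarrow> 'c" where
  "right_int T a b \<beta> h t =
     (if \<beta> = 0 then h t
      else LINT s:{t..<b}|delta_measure T a b. right_integrand (ts_interval T a b) \<beta> h t s)"

text \<open>The Riemann--Liouville derivatives at a point. A Bochner integral that does not exist is \<open>0\<close>
  by convention; the first conjunct rules out derivatives computed from such values.\<close>

definition has_left_RL_deriv ::
    "real set \<Rightarrow> real \<Rightarrow> real \<Rightarrow> real \<Rightarrow> (real \<Rightarrow> 'c::euclidean_space) \<Rightarrow> real \<Rightarrow> 'c \<Rightarrow> bool" where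
  "has_left_RL_deriv T a b \<alpha> h t d \<longleftrightarrow>
     (\<exists>\<delta>>0. \<forall>s\<in>ts_interval T a b. \<bar>s - t\<bar> < \<delta> \<or> s = fwd_jump (ts_interval T a b) t \<longrightarrow>
        left_int_exists T a b (1 - \<alpha>) h s) \<and>
     has_delta_deriv (ts_interval T a b) (left_int T a b (1 - \<alpha>) h) t d"

definition has_right_RL_deriv ::
    "real set \<Rightarrow> real \<Rightarrow> real \<Rightarrow> real \<Rightarrow> (real \<Rightarrow> 'c::euclidean_space) \<Rightarrow> real \<Rightarrow> 'c \<Rightarrow> bool" where
  "has_right_RL_deriv T a b \<alpha> h t d \<longleftrightarrow>
     (\<exists>\<delta>>0. \<forall>s\<in>ts_interval T a b. \<bar>s - t\<bar> < \<delta> \<or> s = fwd_jump (ts_interval T a b) t \<longrightarrow>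
        right_int_exists T a b (1 - \<alpha>) h s) \<and>
     has_delta_deriv (ts_interval T a b) (right_int T a b (1 - \<alpha>) h) t (- d)"

section \<open>The right fractional Sobolev space\<close>

text \<open>
  \<open>g\<close> is a weak right derivative of \<open>u\<close>; \<open>\<psi>\<close> is the left Riemann--Liouville derivative of the
  test function \<open>\<phi>\<close>. The defining identity is meaningful for every \<open>u\<close> in \<open>L\<^sup>p\<close> exactly when
  \<open>\<psi>\<close> exists almost everywhere and lies in \<open>L\<^sup>q\<close>, \<open>q = p / (p - 1)\<close>. This holds for all
  \<open>\<phi>\<close> if \<open>T\<close> contains the interval from \<open>a\<close> to \<open>b\<close>. On time scales where the kernel
  singularity makes it fail for some \<open>\<phi>\<close>, those \<open>\<phi>\<close> impose no condition.
\<close>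

definition weak_right_deriv ::
    "real set \<Rightarrow> real \<Rightarrow> real \<Rightarrow> real \<Rightarrow> real \<Rightarrow>
      (real \<Rightarrow> 'c::euclidean_space) \<Rightarrow> (real \<Rightarrow> 'c) \<Rightarrow> bool" where
  "weak_right_deriv T a b \<alpha> p u g \<longleftrightarrow>
     g \<in> lp_functions T a b p \<and>
     (\<forall>\<phi> \<psi>. test_function T a b \<phi> \<and>
        (AE t in delta_measure T a b. has_left_RL_deriv T a b \<alpha> \<phi> t (\<psi> t)) \<and>
        \<psi> \<in> lp_functions T a b (p / (p - 1)) \<longrightarrow>
        (LINT t|delta_measure T a b. u t \<bullet> \<psi> t) = (LINT t|delta_measure T a b. g t \<bullet> \<phi> t))"

text \<open>
  \<open>g\<close> is the pointwise right Riemann--Liouville derivative of the class of \<open>u\<close>. For \<open>\<alpha> = 1\<close>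
  this is the classical delta derivative, which only suitable representatives of a class possess.
\<close>

definition RL_right_deriv ::
    "real set \<Rightarrow> real \<Rightarrow> real \<Rightarrow> real \<Rightarrow> real \<Rightarrow>
      (real \<Rightarrow> 'c::euclidean_space) \<Rightarrow> (real \<Rightarrow> 'c) \<Rightarrow> bool" where
  "RL_right_deriv T a b \<alpha> p u g \<longleftrightarrow>
     g \<in> lp_functions T a b p \<and>
     (\<exists>v\<in>ae_class T a b p u. AE t in delta_measure T a b. has_right_RL_deriv T a b \<alpha> v t (g t))"

text \<open>
  The known property of the classical case: every \<open>u\<close> in the Sobolev space has a pointwise right
  derivative almost everywhere, it lies in \<open>L\<^sup>p\<close>, and it equals the weak derivative. It can fail on
  time scales with scattered points: for \<open>T = \<int>\<close> and \<open>\<alpha> = 1\<close> the weak derivative is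
  \<open>u (t - 1) - u t\<close>, the pointwise one \<open>u t - u (t + 1)\<close>.
\<close>

definition RL_deriv_is_weak_deriv ::
    "real set \<Rightarrow> real \<Rightarrow> real \<Rightarrow> real \<Rightarrow> real \<Rightarrow> 'c::euclidean_space itself \<Rightarrow> bool" where
  "RL_deriv_is_weak_deriv T a b \<alpha> p (_ :: 'c itself) \<longleftrightarrow>
     (\<forall>u\<in>lp_functions T a b p. \<forall>g :: real \<Rightarrow> 'c. weak_right_deriv T a b \<alpha> p u g \<longrightarrow>
        (\<exists>h. RL_right_deriv T a b \<alpha> p u h) \<and>
        (\<forall>h. RL_right_deriv T a b \<alpha> p u h \<longrightarrow> (AE t in delta_measure T a b. h t = g t)))"

text \<open>
  The space of almost-everywhere classes of functions having a weak right derivative, with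
  \<open>\<parallel>U\<parallel>\<^sup>p = \<parallel>u\<parallel>\<^sup>p + \<parallel>g\<parallel>\<^sup>p\<close>, where \<open>u\<close> represents \<open>U\<close> and the derivative \<open>g\<close> of \<open>u\<close> is given by the
  relation \<open>D\<close>. If \<open>g\<close> is unique almost everywhere, all elements of the set under \<^const>\<open>Inf\<close>
  are equal. A weak derivative need not be unique: if \<open>a\<close> is right-scattered, then \<open>{a}\<close> has positive
  measure but test functions vanish at \<open>a\<close>, so the value of \<open>g\<close> there is free. The infimum then
  picks the derivative of least norm.
\<close>

definition right_sobolev_space ::
    "real set \<Rightarrow> real \<Rightarrow> real \<Rightarrow> real \<Rightarrow> real \<Rightarrow>
      ((real \<Rightarrow> 'c::euclidean_space) \<Rightarrow> (real \<Rightarrow> 'c) \<Rightarrow> bool) \<Rightarrow> (real \<Rightarrow> 'c) set nspace" where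
  "right_sobolev_space T a b \<alpha> p D =
    \<lparr>pts = {ae_class T a b p u | u.
              u \<in> lp_functions T a b p \<and> (\<exists>g. weak_right_deriv T a b \<alpha> p u g)},
     vzero = ae_class T a b p (\<lambda>_. 0),
     vadd = (\<lambda>U V. {w \<in> lp_functions T a b p.
               \<exists>u\<in>U. \<exists>v\<in>V. AE t in delta_measure T a b. w t = u t + v t}),
     vscale = (\<lambda>c U. {w \<in> lp_functions T a b p.
               \<exists>u\<in>U. AE t in delta_measure T a b. w t = c *\<^sub>R u t}),
     vnorm = (\<lambda>U. Inf {(lp_norm T a b p u powr p + lp_norm T a b p g powr p) powr (1 / p) | u g.
               u \<in> U \<and> D u g})\<rparr>"

end

theory Submission
  imports Defs
begin

text \<open>
  The graphs of weak derivatives form a linear subspace of \<open>L\<^sup>p \<times> L\<^sup>p\<close> that is closed under dominated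
  almost-everywhere limits, and the Sobolev space with its norm is a quotient of this subspace, since
  a weak derivative need not be unique. The space \<open>L\<^sup>p \<times> L\<^sup>p\<close> satisfies the inequality
  \<open>\<parallel>x - y\<parallel>\<^sup>p \<le> \<epsilon> (\<parallel>x\<parallel>\<^sup>p + \<parallel>y\<parallel>\<^sup>p) + C ((\<parallel>x\<parallel>\<^sup>p + \<parallel>y\<parallel>\<^sup>p) / 2 - \<parallel>(x + y) / 2\<parallel>\<^sup>p)\<close>,
  which passes to subspaces and quotients and implies uniform convexity. A fast Cauchy sequence in
  the quotient lifts to a dominated series of graphs, so the space is complete, and the
  Milman--Pettis theorem gives reflexivity. If the Riemann--Liouville derivative is a weak
  derivative, then it determines the same norm.
\<close>

section \<open>Duals of normed spaces and the Milman--Pettis theorem\<close>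

text \<open>A weak derivative is constrained through pairings with fixed functions only:
  \<open>u\<close> with \<open>\<psi>\<close> and \<open>g\<close> with \<open>\<phi>\<close>. Both
  fixed functions lie in L^q, \<open>\<psi>\<close> by definition and \<open>\<phi>\<close> because
  an rd-continuous function on a compact set is bounded and the delta measure is finite. By Young's
  inequality both pairings pass to limits that are dominated in p-th power. The fractional
  derivative enters as the choice of the admissible pairs of \<open>\<phi>\<close> and
  \<open>\<psi>\<close>.

  The obstacle is the infimum in the norm, which is not shown to be attained. Norm estimates are
  therefore first made for representatives and derivatives whose p-th powers add up to less than
  \<open>r powr p\<close>, for any \<open>r\<close> above the norm, and then \<open>r\<close>
  decreases to the norm. This fits an inequality between p-th powers: they add over the two
  components \<open>u\<close> and \<open>g\<close>, and its midpoint term carries a minus sign, so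
  bounding a quotient norm by that of representatives goes in the right direction for all terms at
  once.\<close>

abbreviation vdiff :: "'v nspace \<Rightarrow> 'v \<Rightarrow> 'v \<Rightarrow> 'v" where
  "vdiff X x y \<equiv> vadd X x (vscale X (- 1) y)"

lemma dual_add: "f \<in> pts (dual X) \<Longrightarrow> x \<in> pts X \<Longrightarrow> y \<in> pts X \<Longrightarrow> f (vadd X x y) = f x + f y"
  and dual_scale: "f \<in> pts (dual X) \<Longrightarrow> x \<in> pts X \<Longrightarrow> f (vscale X c x) = c * f x"
  and dual_extensional: "f \<in> pts (dual X) \<Longrightarrow> f \<in> extensional (pts X)"
  by (auto simp: dual_def)

lemma vadd_dual: "vadd (dual X) f g = (\<lambda>x\<in>pts X. f x + g x)"
  and vscale_dual: "vscale (dual X) c f = (\<lambda>x\<in>pts X. c * f x)"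
  and vzero_dual: "vzero (dual X) = (\<lambda>x\<in>pts X. 0)"
  and vnorm_dual: "vnorm (dual X) f = Sup {\<bar>f x\<bar> | x. x \<in> pts X \<and> vnorm X x \<le> 1}"
  by (simp_all add: dual_def)

text \<open>The records themselves may differ, because the norms need not agree off the carrier. The
  dual evaluates the norm at carrier points only, so the two duals coincide as records, and with
  them the biduals.\<close>

lemma reflexive_cong:
  assumes "reflexive X" and "pts Y = pts X" "vzero Y = vzero X" "vadd Y = vadd X"
    "vscale Y = vscale X" and n: "\<And>x. x \<in> pts X \<Longrightarrow> vnorm Y x = vnorm X x"
  shows "reflexive Y"
proof -
  have "(\<lambda>f. Sup {\<bar>f x\<bar> | x. x \<in> pts X \<and> vnorm Y x \<le> 1}) =
      (\<lambda>f. Sup {\<bar>f x\<bar> | x. x \<in> pts X \<and> vnorm X x \<le> 1})"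
    by (intro ext arg_cong[where f = Sup]) (auto simp: n)
  then have "dual Y = dual X"
    using assms by (simp add: dual_def cong: conj_cong)
  moreover have "real_nspace Y"
  proof -
    interpret X: real_nspace X using assms(1) by (simp add: reflexive_def)
    show ?thesis
      by (unfold_locales, unfold assms(2-5))
        (rule X.add_assoc X.add_commute; assumption |
          simp add: n X.zero_closed X.add_closed X.scale_closed X.add_zero X.add_inverse
            X.scale_add_right X.scale_add_left X.scale_scale X.scale_one X.norm_nonneg
            X.norm_eq_zero_iff X.norm_scale X.norm_triangle)+
  qed
  ultimately show ?thesis
    using assms by (simp add: reflexive_def bidual_embedding_def[abs_def])
qed

context real_nspace
begin

section \<open>Differences and the triangle inequality on a carrier\<close>

lemma diff_closed: "x \<in> pts X \<Longrightarrow> y \<in> pts X \<Longrightarrow> vdiff X x y \<in> pts X"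
  by (simp add: add_closed scale_closed)

lemma add_diff_cancel:
  assumes "x \<in> pts X" "y \<in> pts X"
  shows "vadd X y (vdiff X x y) = x"
proof -
  have "vadd X y (vdiff X x y) = vadd X (vdiff X x y) y"
    using assms by (intro add_commute diff_closed)
  also have "\<dots> = vadd X x (vadd X (vscale X (- 1) y) y)"
    using assms by (simp add: add_assoc scale_closed)
  also have "vadd X (vscale X (- 1) y) y = vzero X"
    using assms by (metis add_commute add_inverse scale_closed)
  finally show ?thesis using assms by (simp add: add_zero)
qed

lemma norm_diff_triangle:
  assumes "x \<in> pts X" "y \<in> pts X" "z \<in> pts X"
  shows "vnorm X (vdiff X x z) \<le> vnorm X (vdiff X x y) + vnorm X (vdiff X y z)"
proof -
  have "vadd X (vdiff X x y) (vdiff X y z) = vadd X (vadd X (vdiff X x y) y) (vscale X (- 1) z)"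
    using assms by (simp add: add_assoc scale_closed add_closed)
  also have "vadd X (vdiff X x y) y = x"
    using add_diff_cancel[OF assms(1,2)] assms by (simp add: add_commute diff_closed)
  finally show ?thesis
    using norm_triangle[of "vdiff X x y" "vdiff X y z"] assms by (simp add: diff_closed)
qed

lemma norm_zero: "vnorm X (vzero X) = 0"
  by (simp add: norm_eq_zero_iff zero_closed)

section \<open>The dual as a normed space\<close>

lemma dual_bdd_above:
  assumes "f \<in> pts (dual X)"
  shows "bdd_above {\<bar>f x\<bar> | x. x \<in> pts X \<and> vnorm X x \<le> 1}"
proof -
  from assms have "\<exists>K. \<forall>x\<in>pts X. \<bar>f x\<bar> \<le> K * vnorm X x"
    by (simp add: dual_def)
  then obtain K where K: "\<And>x. x \<in> pts X \<Longrightarrow> \<bar>f x\<bar> \<le> K * vnorm X x"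
    by blast
  have "\<bar>f x\<bar> \<le> \<bar>K\<bar>" if "x \<in> pts X" "vnorm X x \<le> 1" for x
  proof -
    have "\<bar>f x\<bar> \<le> \<bar>K\<bar> * vnorm X x"
      using K[OF that(1)] norm_nonneg[OF that(1)]
      by (meson abs_ge_self mult_right_mono order_trans)
    also have "\<dots> \<le> \<bar>K\<bar>" using that norm_nonneg[OF that(1)] by (simp add: mult_left_le)
    finally show ?thesis .
  qed
  then show ?thesis by (intro bdd_aboveI[of _ "\<bar>K\<bar>"]) auto
qed

lemma dual_zero: "f \<in> pts (dual X) \<Longrightarrow> f (vzero X) = 0"
  using norm_zero zero_closed by (fastforce simp: dual_def)

lemma dual_diff: "f \<in> pts (dual X) \<Longrightarrow> x \<in> pts X \<Longrightarrow> y \<in> pts X \<Longrightarrow> f (vdiff X x y) = f x - f y"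
  by (simp add: dual_add dual_scale scale_closed)

lemma dual_norm_upper:
  "f \<in> pts (dual X) \<Longrightarrow> x \<in> pts X \<Longrightarrow> vnorm X x \<le> 1 \<Longrightarrow> \<bar>f x\<bar> \<le> vnorm (dual X) f"
  unfolding vnorm_dual by (rule cSup_upper[OF _ dual_bdd_above]) auto

lemma dual_norm_least:
  "(\<And>x. x \<in> pts X \<Longrightarrow> vnorm X x \<le> 1 \<Longrightarrow> \<bar>f x\<bar> \<le> C) \<Longrightarrow> vnorm (dual X) f \<le> C"
  unfolding vnorm_dual using zero_closed norm_zero by (intro cSup_least) auto

lemma dual_norm_nonneg: "f \<in> pts (dual X) \<Longrightarrow> 0 \<le> vnorm (dual X) f"
  using dual_norm_upper[OF _ zero_closed] norm_zero by fastforce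

lemma dual_bound:
  assumes "f \<in> pts (dual X)" "x \<in> pts X"
  shows "\<bar>f x\<bar> \<le> vnorm (dual X) f * vnorm X x"
proof (cases "vnorm X x = 0")
  case True
  then show ?thesis using assms by (simp add: norm_eq_zero_iff dual_zero norm_zero)
next
  case False
  then have pos: "vnorm X x > 0" using norm_nonneg[OF assms(2)] by simp
  have "\<bar>f (vscale X (1 / vnorm X x) x)\<bar> \<le> vnorm (dual X) f"
    using pos assms by (intro dual_norm_upper scale_closed) (auto simp: norm_scale)
  then show ?thesis using pos assms by (simp add: dual_scale abs_mult field_simps)
qed

text \<open>If the absolute value is large at a point where \<open>f\<close> is negative, the
  opposite point lies in the same ball and has the right sign.\<close>

lemma dual_approx:
  assumes "f \<in> pts (dual X)" "c < vnorm (dual X) f"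
  obtains x where "x \<in> pts X" "vnorm X x \<le> 1" "c < f x"
proof -
  have "{\<bar>f x\<bar> | x. x \<in> pts X \<and> vnorm X x \<le> 1} \<noteq> {}"
    using zero_closed norm_zero by auto
  from assms(2) obtain x where x: "x \<in> pts X" "vnorm X x \<le> 1" "c < \<bar>f x\<bar>"
    unfolding vnorm_dual less_cSup_iff[OF \<open>_ \<noteq> {}\<close> dual_bdd_above[OF assms(1)]] by auto
  show thesis
  proof (cases "f x \<ge> 0")
    case True
    then show thesis using x that by auto
  next
    case False
    then show thesis using x that[of "vscale X (- 1) x"] assms
      by (simp add: scale_closed norm_scale dual_scale)
  qed
qed

lemma dual_boundI:
  assumes "f \<in> extensional (pts X)"
    and "\<And>x y. x \<in> pts X \<Longrightarrow> y \<in> pts X \<Longrightarrow> f (vadd X x y) = f x + f y"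
    and "\<And>c x. x \<in> pts X \<Longrightarrow> f (vscale X c x) = c * f x"
    and "\<And>x. x \<in> pts X \<Longrightarrow> \<bar>f x\<bar> \<le> K * vnorm X x"
  shows "f \<in> pts (dual X)"
  unfolding dual_def using assms by simp blast

lemma dual_add_closed:
  assumes "f \<in> pts (dual X)" "g \<in> pts (dual X)"
  shows "vadd (dual X) f g \<in> pts (dual X)"
proof (rule dual_boundI[where K = "vnorm (dual X) f + vnorm (dual X) g"])
  show "\<bar>vadd (dual X) f g x\<bar> \<le> (vnorm (dual X) f + vnorm (dual X) g) * vnorm X x"
    if "x \<in> pts X" for x
    using dual_bound[OF assms(1) that] dual_bound[OF assms(2) that] that
    by (simp add: vadd_dual algebra_simps)
qed (use assms in \<open>auto simp: vadd_dual dual_add dual_scale add_closed scale_closed algebra_simps\<close>)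

lemma dual_scale_closed:
  assumes "f \<in> pts (dual X)"
  shows "vscale (dual X) c f \<in> pts (dual X)"
proof (rule dual_boundI[where K = "\<bar>c\<bar> * vnorm (dual X) f"])
  show "\<bar>vscale (dual X) c f x\<bar> \<le> \<bar>c\<bar> * vnorm (dual X) f * vnorm X x" if "x \<in> pts X" for x
    using mult_left_mono[OF dual_bound[OF assms that], of "\<bar>c\<bar>"] that
    by (simp add: vscale_dual abs_mult mult.assoc)
qed (use assms in \<open>auto simp: vscale_dual dual_add dual_scale add_closed scale_closed algebra_simps\<close>)

lemma dual_zero_closed: "vzero (dual X) \<in> pts (dual X)"
  by (rule dual_boundI[where K = 0]) (auto simp: vzero_dual add_closed scale_closed)

lemma dual_norm_eq_zero_iff:
  assumes "f \<in> pts (dual X)"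
  shows "vnorm (dual X) f = 0 \<longleftrightarrow> f = vzero (dual X)"
proof
  assume "vnorm (dual X) f = 0"
  then have "f x = 0" if "x \<in> pts X" for x using dual_bound[OF assms that] by simp
  then show "f = vzero (dual X)"
    using dual_extensional[OF assms] by (auto simp: vzero_dual extensional_def)
next
  assume "f = vzero (dual X)"
  then have "vnorm (dual X) f \<le> 0" by (intro dual_norm_least) (simp add: vzero_dual)
  then show "vnorm (dual X) f = 0" using dual_norm_nonneg[OF assms] by simp
qed

text \<open>Half of homogeneity is enough: applied to the inverse scalar it gives the other
  half.\<close>

lemma dual_norm_scale_le:
  assumes "f \<in> pts (dual X)"
  shows "vnorm (dual X) (vscale (dual X) c f) \<le> \<bar>c\<bar> * vnorm (dual X) f"
  by (rule dual_norm_least)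
    (use assms in \<open>auto simp: vscale_dual abs_mult intro!: mult_left_mono dual_norm_upper\<close>)

lemma dual_scale_scale:
  "f \<in> pts (dual X) \<Longrightarrow> vscale (dual X) c (vscale (dual X) d f) = vscale (dual X) (c * d) f"
  by (auto simp: vscale_dual)

lemma dual_scale_one: "f \<in> pts (dual X) \<Longrightarrow> vscale (dual X) 1 f = f"
  using dual_extensional[of f X] by (auto simp: vscale_dual extensional_restrict cong: restrict_cong)

lemma dual_norm_scale:
  assumes "f \<in> pts (dual X)"
  shows "vnorm (dual X) (vscale (dual X) c f) = \<bar>c\<bar> * vnorm (dual X) f"
proof (cases "c = 0")
  case True
  then show ?thesis
    using dual_norm_scale_le[OF assms, of c] dual_norm_nonneg[OF dual_scale_closed[OF assms, of c]]
    by simp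
next
  case False
  have "vnorm (dual X) f = vnorm (dual X) (vscale (dual X) (1 / c) (vscale (dual X) c f))"
    using assms False by (simp add: dual_scale_scale dual_scale_one)
  also have "\<dots> \<le> \<bar>1 / c\<bar> * vnorm (dual X) (vscale (dual X) c f)"
    by (intro dual_norm_scale_le dual_scale_closed assms)
  finally show ?thesis
    using dual_norm_scale_le[OF assms, of c] False by (simp add: field_simps)
qed

lemma dual_norm_triangle:
  assumes "f \<in> pts (dual X)" "g \<in> pts (dual X)"
  shows "vnorm (dual X) (vadd (dual X) f g) \<le> vnorm (dual X) f + vnorm (dual X) g"
proof (rule dual_norm_least)
  fix x assume "x \<in> pts X" "vnorm X x \<le> 1"
  then show "\<bar>vadd (dual X) f g x\<bar> \<le> vnorm (dual X) f + vnorm (dual X) g"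
    using dual_norm_upper[OF assms(1), of x] dual_norm_upper[OF assms(2), of x]
    by (simp add: vadd_dual)
qed

text \<open>Interpreting the locale at \<open>dual X\<close> turns every fact about the dual into
  one about the bidual.\<close>

lemma dual_real_nspace: "real_nspace (dual X)"
proof
  fix f assume f: "f \<in> pts (dual X)"
  show "vadd (dual X) f (vzero (dual X)) = f"
    using dual_extensional[OF f] by (auto simp: vadd_dual vzero_dual extensional_def)
qed (auto simp: dual_zero_closed dual_add_closed dual_scale_closed dual_norm_nonneg
    dual_norm_eq_zero_iff dual_norm_scale dual_norm_triangle dual_scale_scale dual_scale_one,
    auto simp: vadd_dual vscale_dual vzero_dual algebra_simps)

text \<open>The bound of \<open>f x\<close> by the product of the two norms is read with
  \<open>x\<close> fixed and \<open>f\<close> varying.\<close>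

lemma bidual_embedding_closed:
  assumes "x \<in> pts X"
  shows "bidual_embedding X x \<in> pts (dual (dual X))"
proof -
  interpret D: real_nspace "dual X" by (rule dual_real_nspace)
  show ?thesis
    by (rule D.dual_boundI[where K = "vnorm X x"])
      (use assms dual_bound[OF _ assms] dual_add_closed dual_scale_closed
        in \<open>auto simp: bidual_embedding_def vadd_dual vscale_dual mult.commute[of "vnorm X x"]\<close>)
qed

text \<open>A slice of the ball is convex, so it contains the midpoint. A functional of norm at most
  1 is bounded by the norm there, hence the midpoint is long and uniform convexity applies.\<close>

lemma slice_small_diameter:
  assumes uc: "\<And>x y. x \<in> pts X \<Longrightarrow> y \<in> pts X \<Longrightarrow> vnorm X x \<le> 1 \<Longrightarrow> vnorm X y \<le> 1 \<Longrightarrow>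
      vnorm X (vscale X (1 / 2) (vadd X x y)) > 1 - \<delta> \<Longrightarrow> vnorm X (vdiff X x y) < \<epsilon>"
    and f: "f \<in> pts (dual X)" "vnorm (dual X) f \<le> 1"
    and x: "x \<in> pts X" "vnorm X x \<le> 1" "f x > 1 - \<delta>"
    and y: "y \<in> pts X" "vnorm X y \<le> 1" "f y > 1 - \<delta>"
  shows "vnorm X (vdiff X x y) < \<epsilon>"
proof (rule uc[OF x(1) y(1) x(2) y(2)])
  let ?m = "vscale X (1 / 2) (vadd X x y)"
  have m: "?m \<in> pts X" using x y by (simp add: add_closed scale_closed)
  have "1 - \<delta> < f ?m" using x y f by (simp add: dual_scale dual_add add_closed)
  also have "\<dots> \<le> vnorm (dual X) f * vnorm X ?m" using dual_bound[OF f(1) m] by simp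
  also have "\<dots> \<le> vnorm X ?m"
    using f(2) norm_nonneg[OF m] mult_right_mono[of "vnorm (dual X) f" 1 "vnorm X ?m"] by simp
  finally show "1 - \<delta> < vnorm X ?m" .
qed

text \<open>
  The usual appeal to Goldstine's theorem is avoided: only slices of pairs of
  functionals \<open>f, g\<close> are needed, and a point that nearly maximises \<open>f + \<lambda> g\<close> exists by the
  definition of the dual norm. Completeness is required only for sequences with geometrically
  decreasing increments.
\<close>

theorem reflexive_if_uniformly_convex:
  assumes complete: "\<And>x :: nat \<Rightarrow> 'v. (\<And>n. x n \<in> pts X) \<Longrightarrow>
      (\<And>n. vnorm X (vdiff X (x (Suc n)) (x n)) \<le> (1 / 2) ^ n) \<Longrightarrow>
      \<exists>y\<in>pts X. (\<lambda>n. vnorm X (vdiff X (x n) y)) \<longlonglongrightarrow> 0"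
    and uc: "\<And>\<epsilon>. \<epsilon> > 0 \<Longrightarrow> \<exists>\<delta>>0. \<forall>x\<in>pts X. \<forall>y\<in>pts X. vnorm X x \<le> 1 \<longrightarrow> vnorm X y \<le> 1 \<longrightarrow>
      vnorm X (vscale X (1 / 2) (vadd X x y)) > 1 - \<delta> \<longrightarrow> vnorm X (vdiff X x y) < \<epsilon>"
  shows "reflexive X"
proof -
  interpret D: real_nspace "dual X" by (rule dual_real_nspace)
  have "\<Phi> \<in> bidual_embedding X ` pts X" if \<Phi>: "\<Phi> \<in> pts (dual (dual X))" for \<Phi>
  proof -
    define M where "M = vnorm (dual (dual X)) \<Phi>"
    have ext: "\<Phi> = bidual_embedding X x" if "\<And>f. f \<in> pts (dual X) \<Longrightarrow> \<Phi> f = f x" for x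
      using dual_extensional[OF \<Phi>] that by (auto simp: bidual_embedding_def extensional_def)
    show ?thesis
    proof (cases "M = 0")
      case True
      have "\<Phi> f = f (vzero X)" if "f \<in> pts (dual X)" for f
        using D.dual_bound[OF \<Phi> that] True that by (simp add: M_def dual_zero)
      then show ?thesis using ext zero_closed by blast
    next
      case False
      then have M: "M > 0" using D.dual_norm_nonneg[OF \<Phi>] by (simp add: M_def)
      \<comment> \<open>Since \<open>\<Phi> f\<close> is at most \<open>M\<close> times the norm of
        \<open>f\<close>, a large value of \<open>\<Phi>\<close> forces a large norm of
        \<open>f\<close>, and thus a point of the ball where \<open>f\<close> is large. This carries
        information from the bidual down to the space.\<close>
      have attain: "\<exists>x\<in>pts X. vnorm X x \<le> 1 \<and> c < f x"
        if "f \<in> pts (dual X)" "M * c < \<Phi> f" for f c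
      proof -
        have "M * c < M * vnorm (dual X) f"
          using that D.dual_bound[OF \<Phi> that(1)] by (simp add: M_def)
        then show ?thesis using M dual_approx[OF that(1), of c] by auto
      qed
      have f_le: "f x \<le> 1" "- 1 \<le> f x"
        if "f \<in> pts (dual X)" "vnorm (dual X) f \<le> 1" "x \<in> pts X" "vnorm X x \<le> 1" for f x
        using dual_norm_upper[of f x] that by auto
      \<comment> \<open>The diameter is half of the admissible increment, because consecutive points
        will be compared through a third point lying in the slices of both.\<close>
      obtain \<delta> where \<delta>: "\<And>n::nat. \<delta> n > 0" and \<delta>_uc: "\<And>n x y. x \<in> pts X \<Longrightarrow> y \<in> pts X \<Longrightarrow>
          vnorm X x \<le> 1 \<Longrightarrow> vnorm X y \<le> 1 \<Longrightarrow>
          vnorm X (vscale X (1 / 2) (vadd X x y)) > 1 - \<delta> n \<Longrightarrow>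
          vnorm X (vdiff X x y) < (1 / 2) ^ Suc n"
      proof -
        have "\<forall>n::nat. \<exists>\<delta>>0. \<forall>x\<in>pts X. \<forall>y\<in>pts X. vnorm X x \<le> 1 \<longrightarrow> vnorm X y \<le> 1 \<longrightarrow>
            vnorm X (vscale X (1 / 2) (vadd X x y)) > 1 - \<delta> \<longrightarrow>
            vnorm X (vdiff X x y) < (1 / 2) ^ Suc n"
          by (intro allI uc) simp
        then show thesis using that by (auto dest!: choice)
      qed
      have slice: "vnorm X (vdiff X x y) < (1 / 2) ^ Suc n"
        if "f \<in> pts (dual X)" "vnorm (dual X) f \<le> 1" "x \<in> pts X" "vnorm X x \<le> 1" "f x > 1 - \<delta> n"
          "y \<in> pts X" "vnorm X y \<le> 1" "f y > 1 - \<delta> n" for f x y n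
        by (rule slice_small_diameter[OF \<delta>_uc that(1,2,3,4,5,6,7,8)])
      \<comment> \<open>The minimum with \<open>\<delta> (n - 1)\<close> lets both
        \<open>\<eta> n\<close> and \<open>\<eta> (Suc n)\<close> be at most half of
        \<open>\<delta> n\<close>, so that two consecutive errors together stay below
        \<open>\<delta> n\<close>. The power of 1/2 makes the error vanish even after division by
        \<open>\<delta> n / 4\<close> further down.\<close>
      define \<eta> where "\<eta> n = min (\<delta> n) (\<delta> (n - 1)) * (1 / 2) ^ Suc n" for n
      have \<eta>: "\<eta> n > 0" "\<eta> n \<le> \<delta> n * (1 / 2) ^ Suc n" "\<eta> n \<le> \<delta> n / 2" "\<eta> (Suc n) \<le> \<delta> n / 2" for n
      proof -
        have pw: "(1 / 2 :: real) ^ Suc k \<le> 1 / 2" for k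
          using power_le_one[of "1 / 2 :: real" k] by simp
        have \<eta>_le: "\<eta> k \<le> d / 2" if "min (\<delta> k) (\<delta> (k - 1)) \<le> d" for k d
          using mult_mono[OF that pw[of k]] \<delta>[of k] \<delta>[of "k - 1"] that
          unfolding \<eta>_def by (auto simp: min_def split: if_splits)
        show "\<eta> n > 0" using \<delta> by (simp add: \<eta>_def)
        show "\<eta> n \<le> \<delta> n * (1 / 2) ^ Suc n"
          unfolding \<eta>_def by (intro mult_right_mono) auto
        show "\<eta> n \<le> \<delta> n / 2" "\<eta> (Suc n) \<le> \<delta> n / 2" by (rule \<eta>_le; simp)+
      qed
      obtain f where f: "\<And>n. f n \<in> pts (dual X)" "\<And>n. vnorm (dual X) (f n) \<le> 1"
        "\<And>n. M * (1 - \<eta> n) < \<Phi> (f n)"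
      proof -
        have "\<exists>g\<in>pts (dual X). vnorm (dual X) g \<le> 1 \<and> M * (1 - \<eta> n) < \<Phi> g" for n
        proof -
          have "M * (1 - \<eta> n) < M" using M \<eta>(1)[of n] by simp
          then show ?thesis
            using D.dual_approx[OF \<Phi>, folded M_def] by blast
        qed
        then show thesis using that by metis
      qed
      obtain x where x: "\<And>n. x n \<in> pts X" "\<And>n. vnorm X (x n) \<le> 1" "\<And>n. 1 - \<eta> n < f n (x n)"
        using attain[OF f(1,3)] by metis
      have "vnorm X (vdiff X (x (Suc n)) (x n)) \<le> (1 / 2) ^ n" for n
      proof -
        \<comment> \<open>Each functional is at most 1 on the ball, so a point that nearly maximises
          the sum nearly maximises both summands.\<close>
        have "M * (2 - \<eta> n - \<eta> (Suc n)) < \<Phi> (vadd (dual X) (f n) (f (Suc n)))"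
          using f(3)[of n] f(3)[of "Suc n"] dual_add[OF \<Phi> f(1) f(1), of n "Suc n"]
          by (simp add: algebra_simps)
        from attain[OF dual_add_closed[OF f(1) f(1)] this] obtain y where
          y: "y \<in> pts X" "vnorm X y \<le> 1" "2 - \<eta> n - \<eta> (Suc n) < f n y + f (Suc n) y"
          by (auto simp: vadd_dual)
        have "f n y \<le> 1" "f (Suc n) y \<le> 1" using f y by (auto intro: f_le)
        then have y': "1 - \<delta> n < f n y" "1 - \<delta> n < f (Suc n) y"
          using y(3) \<eta>(3,4)[of n] by auto
        have "vnorm X (vdiff X (x (Suc n)) y) < (1 / 2) ^ Suc n"
          by (rule slice[OF f(1,2)[of "Suc n"]])
            (use x[of "Suc n"] y y' \<eta>(4)[of n] \<delta>[of n] in auto)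
        moreover have "vnorm X (vdiff X y (x n)) < (1 / 2) ^ Suc n"
          by (rule slice[OF f(1,2)[of n]])
            (use x[of n] y y' \<eta>(3)[of n] \<delta>[of n] in auto)
        ultimately show ?thesis
          using norm_diff_triangle[OF x(1) y(1) x(1), of "Suc n" n] by simp
      qed
      from complete[OF x(1) this] obtain z where
        z: "z \<in> pts X" "(\<lambda>n. vnorm X (vdiff X (x n) z)) \<longlonglongrightarrow> 0" by blast
      \<comment> \<open>One inequality suffices, since it may be applied to the negative of
        \<open>g\<close> as well.\<close>
      have ge: "\<Phi> g / M \<le> g z" if g: "g \<in> pts (dual X)" "vnorm (dual X) g \<le> 1" for g
      proof -
        have bound: "\<Phi> g / M - 2 * (1 / 2) ^ n - (1 / 2) ^ Suc n - vnorm X (vdiff X (x n) z) \<le> g z"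
          for n
        proof -
          \<comment> \<open>Adding \<open>l\<close> times \<open>g\<close> costs at most
            \<open>2 * l = \<delta> n / 2\<close>; with \<open>\<eta> n \<le> \<delta> n / 2\<close>
            a near-maximiser \<open>y\<close> of the perturbed functional stays in the slice of
            \<open>f n\<close>, hence close to \<open>x n\<close>. Comparing the \<open>g\<close>
            parts leaves the error \<open>\<eta> n / l\<close>, which is at most
            \<open>2 * (1 / 2) ^ n\<close>.\<close>
          define l where "l = \<delta> n / 4"
          have l: "l > 0" using \<delta> by (simp add: l_def)
          have "M * (1 - \<eta> n + l * (\<Phi> g / M)) < \<Phi> (f n) + l * \<Phi> g"
            using f(3)[of n] M by (simp add: algebra_simps)
          also have "\<dots> = \<Phi> (vadd (dual X) (f n) (vscale (dual X) l g))"
            using \<Phi> f(1) g by (simp add: dual_add dual_scale dual_scale_closed)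
          finally obtain y where y: "y \<in> pts X" "vnorm X y \<le> 1"
            "1 - \<eta> n + l * (\<Phi> g / M) < f n y + l * g y"
            using attain[OF dual_add_closed[OF f(1) dual_scale_closed[OF g(1)]]]
            by (fastforce simp: vadd_dual vscale_dual)
          have "\<bar>\<Phi> g\<bar> \<le> M"
            using D.dual_norm_upper[OF \<Phi> g] by (simp add: M_def)
          then have "- 1 \<le> \<Phi> g / M" using M by (auto simp: field_simps)
          then have "- l \<le> l * (\<Phi> g / M)"
            using mult_left_mono[of "- 1" "\<Phi> g / M" l] l by simp
          moreover have "l * g y \<le> l" using f_le(1)[OF g y(1,2)] l by (simp add: mult_left_le)
          ultimately have "1 - \<delta> n < f n y"
            using y(3) \<eta>(3)[of n] by (simp add: l_def)
          then have near: "vnorm X (vdiff X y (x n)) < (1 / 2) ^ Suc n"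
            by (intro slice[OF f(1,2)[of n]])
              (use x[of n] y \<eta>(3)[of n] \<delta>[of n] in auto)
          have "l * (\<Phi> g / M) - l * g y \<le> \<eta> n"
            using y(3) f_le(1)[OF f(1,2)[of n] y(1,2)] by linarith
          also have "\<eta> n \<le> l * (2 * (1 / 2) ^ n)"
            using \<eta>(2)[of n] by (simp add: l_def)
          finally have "l * (\<Phi> g / M - g y) \<le> l * (2 * (1 / 2) ^ n)"
            by (simp only: right_diff_distrib)
          then have "\<Phi> g / M - g y \<le> 2 * (1 / 2) ^ n" using l by simp
          moreover have "g y - g z \<le> vnorm X (vdiff X y z)"
          proof -
            have "g y - g z \<le> \<bar>g (vdiff X y z)\<bar>" using g y z by (simp add: dual_diff)
            also have "\<dots> \<le> vnorm (dual X) g * vnorm X (vdiff X y z)"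
              using g y z by (intro dual_bound diff_closed) auto
            also have "\<dots> \<le> vnorm X (vdiff X y z)"
              using mult_right_mono[OF g(2), of "vnorm X (vdiff X y z)"] y z
              by (simp add: norm_nonneg diff_closed)
            finally show ?thesis .
          qed
          ultimately show ?thesis
            using near norm_diff_triangle[OF y(1) x(1) z(1), of n] by simp
        qed
        have "(\<lambda>n. \<Phi> g / M - 2 * (1 / 2) ^ n - (1 / 2) ^ Suc n - vnorm X (vdiff X (x n) z))
            \<longlonglongrightarrow> \<Phi> g / M - 2 * 0 - 0 - 0"
          by (intro tendsto_intros z LIMSEQ_Suc LIMSEQ_power_zero) auto
        then show ?thesis using LIMSEQ_le_const2[of _ "\<Phi> g / M" "g z"] bound by auto
      qed
      have "\<Phi> g = g (vscale X M z)" if g: "g \<in> pts (dual X)" for g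
      proof -
        \<comment> \<open>This scales \<open>g\<close> into the unit ball; the summand 1 keeps the
          denominator positive when \<open>g\<close> has norm 0. The representing point is
          \<open>M\<close> times \<open>z\<close>, because \<open>z\<close> belongs to
          \<open>\<Phi>\<close> divided by its norm.\<close>
        define c where "c = 1 / (vnorm (dual X) g + 1)"
        have c: "c > 0" using dual_norm_nonneg[OF g] by (simp add: c_def)
        define h where "h = vscale (dual X) c g"
        have h: "h \<in> pts (dual X)" "vnorm (dual X) h \<le> 1"
          using c g dual_norm_nonneg[OF g]
          by (auto simp: h_def dual_scale_closed dual_norm_scale c_def)
        define k where "k = vscale (dual X) (- 1) h"
        have k: "k \<in> pts (dual X)" "vnorm (dual X) k \<le> 1"
          using h by (auto simp: k_def dual_scale_closed dual_norm_scale)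
        have "\<Phi> h = c * \<Phi> g" "\<Phi> k = - \<Phi> h" "h z = c * g z" "k z = - h z"
          using dual_scale[OF \<Phi> g, of c] dual_scale[OF \<Phi> h(1), of "- 1"] z
          by (simp_all add: k_def h_def vscale_dual)
        then have "c * \<Phi> g / M = c * g z" using ge[OF h] ge[OF k] by simp
        then show ?thesis using c M g z by (simp add: dual_scale field_simps)
      qed
      then show ?thesis using ext z scale_closed by blast
    qed
  qed
  then show ?thesis
    using bidual_embedding_closed real_nspace_axioms by (auto simp: reflexive_def)
qed

end

section \<open>Uniform convexity of the \<open>p\<close>-th power of the norm\<close>

text \<open>Bernoulli's inequality in strict form. The mean value theorem gives the slope at an
  intermediate point, which is above \<open>p\<close> to the right of 1 and below \<open>p\<close>
  to the left, as required on either side. The point 0 is treated apart because the derivative rule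
  is applied at positive points.\<close>

lemma powr_gt_tangent:
  fixes x p :: real
  assumes "1 < p" "0 \<le> x" "x \<noteq> 1"
  shows "1 + p * (x - 1) < x powr p"
proof (cases "x = 0")
  case False
  then have x: "x > 0" using assms by simp
  have D: "((\<lambda>x. x powr p) has_real_derivative p * y powr (p - 1)) (at y)" if "y > 0" for y
    using that by (rule has_real_derivative_powr)
  show ?thesis
  proof (cases "x > 1")
    case True
    obtain \<xi> where \<xi>: "1 < \<xi>" "x powr p - 1 powr p = (x - 1) * (p * \<xi> powr (p - 1))"
      using MVT2[OF True, of "\<lambda>x. x powr p" "\<lambda>y. p * y powr (p - 1)"] D by auto
    have "1 < \<xi> powr (p - 1)" using \<xi>(1) assms by simp
    then have "(x - 1) * p * 1 < (x - 1) * p * \<xi> powr (p - 1)"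
      using True assms by (intro mult_strict_left_mono) auto
    then show ?thesis using \<xi>(2) by (simp add: algebra_simps)
  next
    case False
    then have lt: "x < 1" using assms by simp
    obtain \<xi> where \<xi>: "x < \<xi>" "\<xi> < 1" "1 powr p - x powr p = (1 - x) * (p * \<xi> powr (p - 1))"
      using MVT2[OF lt, of "\<lambda>x. x powr p" "\<lambda>y. p * y powr (p - 1)"] D x by force
    have "\<xi> powr (p - 1) < 1" using powr_less_mono2[of "p - 1" \<xi> 1] \<xi>(1,2) x assms by simp
    then have "(1 - x) * p * \<xi> powr (p - 1) < (1 - x) * p * 1"
      using lt assms by (intro mult_strict_left_mono) auto
    then show ?thesis using \<xi>(3) by (simp add: algebra_simps)
  qed
qed (use assms in simp)

lemma powr_ge_tangent:
  fixes x m p :: real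
  assumes "1 < p" "0 \<le> x" "0 < m"
  shows "m powr p + p * m powr (p - 1) * (x - m) \<le> x powr p"
    and "x \<noteq> m \<Longrightarrow> m powr p + p * m powr (p - 1) * (x - m) < x powr p"
proof -
  have eq: "x powr p = m powr p * (x / m) powr p"
    using assms by (simp add: powr_divide)
  have eq': "m powr p + p * m powr (p - 1) * (x - m) = m powr p * (1 + p * (x / m - 1))"
    using assms by (simp add: powr_diff field_simps)
  show strict: "m powr p + p * m powr (p - 1) * (x - m) < x powr p" if "x \<noteq> m"
    unfolding eq eq' using assms that
    by (intro mult_strict_left_mono powr_gt_tangent) auto
  show "m powr p + p * m powr (p - 1) * (x - m) \<le> x powr p"
    by (cases "x = m") (use strict in auto)
qed

text \<open>Strictness has two sources. If the norms differ, it comes from the power function: the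
  tangent terms at the mean \<open>m\<close> cancel. If they agree, the parallelogram law makes the
  midpoint shorter.\<close>

lemma norm_midpoint_powr_less:
  fixes x y :: "'c::real_inner"
  assumes p: "1 < p" and "x \<noteq> y"
  shows "norm ((1 / 2) *\<^sub>R (x + y)) powr p < (norm x powr p + norm y powr p) / 2"
proof -
  define m where "m = (norm x + norm y) / 2"
  have m: "m > 0"
    using assms(2) by (cases "x = 0") (auto simp: m_def intro: add_pos_nonneg)
  have le: "norm ((1 / 2) *\<^sub>R (x + y)) \<le> m"
    using norm_triangle_ineq[of x y] by (simp add: m_def)
  have x: "norm x - m = - (norm y - m)" by (simp add: m_def field_simps)
  show ?thesis
  proof (cases "norm x = norm y")
    case False
    then have "norm x \<noteq> m" "norm y \<noteq> m" by (auto simp: m_def)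
    then have "m powr p + p * m powr (p - 1) * (norm x - m) < norm x powr p"
      "m powr p + p * m powr (p - 1) * (norm y - m) < norm y powr p"
      using p m by (auto intro: powr_ge_tangent)
    then have "m powr p < (norm x powr p + norm y powr p) / 2"
      unfolding x by (simp add: algebra_simps)
    moreover have "norm ((1 / 2) *\<^sub>R (x + y)) powr p \<le> m powr p"
      using le p by (intro powr_mono2) auto
    ultimately show ?thesis by simp
  next
    case True
    have "norm (x + y) ^ 2 + norm (x - y) ^ 2 = 4 * norm x ^ 2"
      using True[unfolded norm_eq] by (simp add: power2_norm_eq_inner inner_simps inner_commute)
    moreover have "norm (x - y) ^ 2 > 0" using assms(2) by simp
    moreover have "(2 * norm x) ^ 2 = 4 * norm x ^ 2" by simp
    ultimately have "norm (x + y) ^ 2 < (2 * norm x) ^ 2" by linarith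
    then have "norm (x + y) < 2 * norm x" by (rule power_less_imp_less_base) simp
    then have "norm ((1 / 2) *\<^sub>R (x + y)) powr p < norm x powr p"
      using p by (intro powr_less_mono2) auto
    then show ?thesis using True by simp
  qed
qed

lemma norm_midpoint_powr_le:
  fixes x y :: "'c::real_inner"
  assumes p: "1 < p"
  shows "norm ((1 / 2) *\<^sub>R (x + y)) powr p \<le> (norm x powr p + norm y powr p) / 2"
  using norm_midpoint_powr_less[OF p, of x y] by (cases "x = y") (auto simp flip: scaleR_2)

text \<open>
  Unlike Clarkson's inequalities this form of uniform convexity is linear in the \<open>p\<close>-th powers,
  so it survives integration, summation over components and passage to a quotient norm, and it
  treats all exponents \<open>p > 1\<close> alike. By homogeneity it suffices to consider the compact set
  \<open>\<parallel>x\<parallel>\<^sup>p + \<parallel>y\<parallel>\<^sup>p = 1\<close>, where strict convexity bounds the gap from below.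
\<close>

lemma norm_powr_uniformly_convex:
  fixes p \<epsilon> :: real
  assumes p: "1 < p" and \<epsilon>: "0 < \<epsilon>"
  obtains C where "0 \<le> C" "\<And>x y :: 'c::euclidean_space. norm (x - y) powr p \<le>
    \<epsilon> * (norm x powr p + norm y powr p) +
    C * ((norm x powr p + norm y powr p) / 2 - norm ((1 / 2) *\<^sub>R (x + y)) powr p)"
proof -
  define s where "s z = norm (fst z) powr p + norm (snd z) powr p" for z :: "'c \<times> 'c"
  define d where "d z = norm (fst z - snd z) powr p" for z :: "'c \<times> 'c"
  define e where "e z = s z / 2 - norm ((1 / 2) *\<^sub>R (fst z + snd z)) powr p" for z :: "'c \<times> 'c"
  have cont: "continuous_on UNIV s" "continuous_on UNIV d" "continuous_on UNIV e"
    unfolding s_def d_def e_def using p by (auto intro!: continuous_intros continuous_on_powr')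
  have e0: "e z \<ge> 0" for z
    using norm_midpoint_powr_le[OF p, of "fst z" "snd z"] by (simp add: e_def s_def)
  have e_pos: "e z > 0" if "d z > 0" for z
    using norm_midpoint_powr_less[OF p, of "fst z" "snd z"] that by (auto simp: e_def s_def d_def)
  define K where "K = {z. s z = 1 \<and> d z \<ge> \<epsilon>}"
  have "compact K"
  proof (rule compact_eq_bounded_closed[THEN iffD2])
    have "closed {z. s z = 1}" "closed {z. \<epsilon> \<le> d z}"
      by (intro closed_Collect_eq closed_Collect_le cont continuous_on_const)+
    then have "closed K" unfolding K_def by (simp add: Collect_conj_eq closed_Int)
    moreover have "bounded K"
    proof (rule boundedI[of _ 2])
      fix z assume "z \<in> K"
      then have "norm (fst z) powr p + norm (snd z) powr p = 1" by (simp add: K_def s_def)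
      moreover have "0 \<le> norm (fst z) powr p" "0 \<le> norm (snd z) powr p" by simp_all
      ultimately have "norm (fst z) powr p \<le> 1 powr p" "norm (snd z) powr p \<le> 1 powr p"
        unfolding powr_one_eq_one by linarith+
      then have "norm (fst z) \<le> 1" "norm (snd z) \<le> 1"
        using p powr_less_mono2[of p 1] by (auto simp flip: not_less)
      then show "norm z \<le> 2" using norm_Pair_le[of "fst z" "snd z"] by simp
    qed
    ultimately show "bounded K \<and> closed K" by simp
  qed
  \<comment> \<open>The constant is the maximum of \<open>d / e\<close> over \<open>K\<close>, where
    \<open>e\<close> is positive because \<open>d\<close> is. If \<open>K\<close> is empty, for
    instance when \<open>\<epsilon>\<close> is large, 0 serves.\<close>
  obtain C where C: "0 \<le> C" "\<And>z. z \<in> K \<Longrightarrow> d z \<le> C * e z"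
  proof (cases "K = {}")
    case False
    have "e z \<noteq> 0" if "z \<in> K" for z using e_pos[of z] that \<epsilon> by (force simp: K_def)
    then have "continuous_on K (\<lambda>z. d z / e z)"
      by (intro continuous_on_divide continuous_on_subset[OF cont(2)] continuous_on_subset[OF cont(3)]) auto
    from continuous_attains_sup[OF \<open>compact K\<close> False this] obtain w where
      w: "w \<in> K" "\<And>z. z \<in> K \<Longrightarrow> d z / e z \<le> d w / e w" by blast
    have "0 \<le> d w / e w" using e0[of w] by (simp add: d_def)
    moreover have "d z \<le> d w / e w * e z" if "z \<in> K" for z
      using w(2)[OF that] e_pos[of z] that \<epsilon> by (simp add: K_def pos_divide_le_eq)
    ultimately show thesis using that by blast
  qed (use that[of 0] in simp)
  have "d z \<le> \<epsilon> * s z + C * e z" for z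
  proof (cases "s z = 0")
    case True
    then have "norm (fst z) powr p = 0" "norm (snd z) powr p = 0"
      unfolding s_def by (auto simp: add_nonneg_eq_0_iff)
    then have "d z = 0" by (simp add: d_def)
    then show ?thesis using True C e0[of z] by simp
  next
    case False
    then have s: "s z > 0" by (simp add: s_def add_nonneg_pos order.not_eq_order_implies_strict)
    \<comment> \<open>The functions \<open>s\<close>, \<open>d\<close> and \<open>e\<close> are
      homogeneous of degree \<open>p\<close>; this factor moves \<open>z\<close> to the set where
      \<open>s\<close> is 1. There either the point is in \<open>K\<close>, or \<open>d\<close> is
      below \<open>\<epsilon>\<close> and the first term alone suffices.\<close>
    define r where "r = s z powr (- 1 / p)"
    have r: "r > 0" "r powr p = 1 / s z"
    proof -
      have "r powr p = s z powr (- 1 / p * p)" by (simp only: r_def powr_powr)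
      then show "r powr p = 1 / s z" using s p by (simp add: powr_minus_divide)
    qed (use s in \<open>simp add: r_def\<close>)
    have [simp]: "r * (1 / 2) = 1 / 2 * r" by simp
    have hom: "s (r *\<^sub>R z) = 1 / s z * s z" "d (r *\<^sub>R z) = 1 / s z * d z" "e (r *\<^sub>R z) = 1 / s z * e z"
    proof -
      have n: "norm (r *\<^sub>R v) powr p = 1 / s z * norm v powr p" for v :: 'c
        using r by (simp add: powr_mult)
      show s': "s (r *\<^sub>R z) = 1 / s z * s z"
        unfolding s_def[of "r *\<^sub>R z"] fst_scaleR snd_scaleR n by (simp only: s_def[of z] distrib_left)
      show "d (r *\<^sub>R z) = 1 / s z * d z"
        unfolding d_def fst_scaleR snd_scaleR scaleR_diff_right[symmetric] n ..
      have "(1 / 2) *\<^sub>R (r *\<^sub>R fst z + r *\<^sub>R snd z) = r *\<^sub>R ((1 / 2) *\<^sub>R (fst z + snd z))"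
        by (simp add: algebra_simps)
      then show "e (r *\<^sub>R z) = 1 / s z * e z"
        unfolding e_def s' fst_scaleR snd_scaleR by (simp only: n right_diff_distrib times_divide_eq_right)
    qed
    have "d (r *\<^sub>R z) \<le> \<epsilon> + C * e (r *\<^sub>R z)"
    proof (cases "d (r *\<^sub>R z) \<ge> \<epsilon>")
      case True
      then have "r *\<^sub>R z \<in> K" using hom(1) s by (simp add: K_def)
      then show ?thesis using C(2)[of "r *\<^sub>R z"] \<epsilon> by simp
    next
      case False
      then show ?thesis using mult_nonneg_nonneg[OF C(1) e0[of "r *\<^sub>R z"]] by linarith
    qed
    then show ?thesis using s unfolding hom by (simp add: field_simps)
  qed
  note * = this
  have "norm (x - y) powr p \<le> \<epsilon> * (norm x powr p + norm y powr p) +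
    C * ((norm x powr p + norm y powr p) / 2 - norm ((1 / 2) *\<^sub>R (x + y)) powr p)" for x y :: 'c
    using *[of "(x, y)"] by (simp only: s_def d_def e_def fst_conv snd_conv)
  then show thesis using that C(1) by blast
qed

text \<open>Convexity of \<open>t \<mapsto> t\<^sup>p\<close>, homogenised in the weights \<open>s\<close> and \<open>t\<close>.\<close>

lemma norm_add_powr_le:
  fixes x y :: "'c::real_normed_vector"
  assumes p: "1 < p" and s: "0 < s" and t: "0 < t"
  shows "norm (x + y) powr p \<le>
    (s + t) powr (p - 1) * (norm x powr p / s powr (p - 1) + norm y powr p / t powr (p - 1))"
proof (cases "norm x + norm y = 0")
  case False
  \<comment> \<open>\<open>m\<close> is the mean of \<open>X\<close> and \<open>Y\<close> with
    weights \<open>s\<close> and \<open>t\<close>, so in the weighted sum of the tangent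
    inequalities at \<open>m\<close> the linear terms cancel.\<close>
  define X Y m where "X = norm x / s" and "Y = norm y / t" and "m = (norm x + norm y) / (s + t)"
  have m: "m > 0" using False s t unfolding m_def
    by (intro divide_pos_pos) (auto intro: order.not_eq_order_implies_strict)
  have XY: "X \<ge> 0" "Y \<ge> 0" using s t by (auto simp: X_def Y_def)
  have bal: "s * (X - m) + t * (Y - m) = 0"
  proof -
    have "s * X = norm x" "t * Y = norm y" "(s + t) * m = norm x + norm y"
      using s t by (simp_all add: X_def Y_def m_def)
    then show ?thesis by (simp add: algebra_simps)
  qed
  have "s * (m powr p + p * m powr (p - 1) * (X - m)) + t * (m powr p + p * m powr (p - 1) * (Y - m))
      = (s + t) * m powr p + p * m powr (p - 1) * (s * (X - m) + t * (Y - m))"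
    by (simp add: algebra_simps)
  then have "(s + t) * m powr p \<le> s * X powr p + t * Y powr p"
    using mult_left_mono[OF powr_ge_tangent(1)[OF p XY(1) m], of s]
      mult_left_mono[OF powr_ge_tangent(1)[OF p XY(2) m], of t] s t unfolding bal by linarith
  moreover have "s * X powr p = norm x powr p / s powr (p - 1)" "t * Y powr p = norm y powr p / t powr (p - 1)"
    using s t by (simp_all add: X_def Y_def powr_divide powr_diff)
  moreover have "(norm x + norm y) powr p = (s + t) powr (p - 1) * ((s + t) * m powr p)"
    using s t by (simp add: m_def powr_divide powr_diff)
  ultimately have "(norm x + norm y) powr p \<le>
      (s + t) powr (p - 1) * (norm x powr p / s powr (p - 1) + norm y powr p / t powr (p - 1))"
    by (simp add: mult_left_mono)
  moreover have "norm (x + y) powr p \<le> (norm x + norm y) powr p"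
    using p by (intro powr_mono2 norm_triangle_ineq) auto
  ultimately show ?thesis by simp
next
  case True
  then have "x = 0" "y = 0" by (simp_all add: add_nonneg_eq_0_iff)
  then show ?thesis by simp
qed

text \<open>Jensen's inequality by induction: the first \<open>n\<close> summands are merged into
  one whose weight is the partial sum of the weights. For \<open>n = 0\<close> that weight would be
  0, hence the case split.\<close>

lemma norm_sum_powr_le:
  fixes x :: "nat \<Rightarrow> 'c::real_normed_vector"
  assumes p: "1 < p" and s: "\<And>k. 0 < s k"
  shows "norm (\<Sum>k<n. x k) powr p \<le> (\<Sum>k<n. s k) powr (p - 1) * (\<Sum>k<n. norm (x k) powr p / s k powr (p - 1))"
proof (induction n)
  case (Suc n)
  show ?case
  proof (cases "n = 0")
    case True
    then show ?thesis using s[of 0] by simp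
  next
    case False
    then have pos: "(\<Sum>k<n. s k) > 0" using s by (intro sum_pos) auto
    have "norm ((\<Sum>k<n. x k) + x n) powr p \<le> ((\<Sum>k<n. s k) + s n) powr (p - 1) *
       (norm (\<Sum>k<n. x k) powr p / (\<Sum>k<n. s k) powr (p - 1) + norm (x n) powr p / s n powr (p - 1))"
      by (rule norm_add_powr_le[OF p pos s])
    also have "\<dots> \<le> ((\<Sum>k<n. s k) + s n) powr (p - 1) *
       ((\<Sum>k<n. norm (x k) powr p / s k powr (p - 1)) + norm (x n) powr p / s n powr (p - 1))"
      using Suc.IH pos by (intro mult_left_mono add_right_mono) (auto simp: field_simps)
    finally show ?thesis by simp
  qed
qed simp

text \<open>With the weights \<open>(1 / 2) ^ k\<close>, of total at most 2, Jensen's inequality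
  bounds the p-th powers of all partial sums by one series of functions \<open>g k\<close>. The
  integral of \<open>g k\<close> is at most a constant times
  \<open>s k powr p / s k powr (p - 1) = s k\<close>, so that series has an integrable sum.\<close>

lemma Lp_series_dominated:
  fixes f :: "nat \<Rightarrow> 'a \<Rightarrow> 'c::{banach, second_countable_topology}"
  assumes p: "1 < p" and meas: "\<And>k. f k \<in> borel_measurable M"
    and int: "\<And>k. integrable M (\<lambda>t. norm (f k t) powr p)"
    and le: "\<And>k. (LINT t|M. norm (f k t) powr p) \<le> (c * (1 / 2) ^ k) powr p" and c: "0 \<le> c"
  obtains w :: "'a \<Rightarrow> real" where "integrable M w"
    and "AE t in M. summable (\<lambda>k. f k t)"
    and "AE t in M. \<forall>n. norm (\<Sum>k<n. f k t) powr p \<le> w t"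
    and "AE t in M. norm (\<Sum>k. f k t) powr p \<le> w t"
proof -
  define s where "s k = (1 / 2 :: real) ^ k" for k :: nat
  have s: "s k > 0" for k by (simp add: s_def)
  have sum_s: "(\<Sum>k<n. s k) \<le> 2" for n
    using sum_le_suminf[of s "{..<n}"] suminf_geometric[of "1 / 2 :: real"]
    by (simp add: s_def[abs_def] summable_geometric)
  define g where "g k t = 2 powr (p - 1) * (norm (f k t) powr p / s k powr (p - 1))" for k t
  have g0: "g k t \<ge> 0" for k t by (simp add: g_def)
  have g_int: "integrable M (g k)" for k
    unfolding g_def by (intro integrable_mult_right integrable_divide int)
  have g_le: "(LINT t|M. g k t) \<le> 2 powr (p - 1) * c powr p * s k" for k
  proof -
    have "(LINT t|M. g k t) = 2 powr (p - 1) * ((LINT t|M. norm (f k t) powr p) / s k powr (p - 1))"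
      by (simp add: g_def)
    also have "\<dots> \<le> 2 powr (p - 1) * ((c * s k) powr p / s k powr (p - 1))"
      using le[of k] by (intro mult_left_mono divide_right_mono) (auto simp: s_def)
    also have "\<dots> = 2 powr (p - 1) * c powr p * s k"
      using c s[of k] by (simp add: powr_mult powr_diff)
    finally show ?thesis .
  qed
  have summ_int: "summable (\<lambda>k. LINT t|M. g k t)"
  proof (rule summable_comparison_test'[where N = 0])
    show "summable (\<lambda>k. 2 powr (p - 1) * c powr p * s k)"
      unfolding s_def by (intro summable_mult summable_geometric) simp
    show "norm (LINT t|M. g k t) \<le> 2 powr (p - 1) * c powr p * s k" for k
      using g_le[of k] g0 by (simp add: integral_nonneg_AE)
  qed
  have summ: "AE t in M. summable (\<lambda>k. g k t)"
  proof -
    have "(\<integral>\<^sup>+t. (\<Sum>k. ennreal (g k t)) \<partial>M) = (\<Sum>k. \<integral>\<^sup>+t. ennreal (g k t) \<partial>M)"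
      using g_int by (intro nn_integral_suminf) auto
    also have "\<dots> = (\<Sum>k. ennreal (LINT t|M. g k t))"
      using g_int g0 by (intro suminf_cong nn_integral_eq_integral) auto
    also have "\<dots> \<noteq> \<infinity>"
      using summ_int g0 by (simp add: suminf_ennreal2 integral_nonneg_AE)
    finally have "AE t in M. (\<Sum>k. ennreal (g k t)) \<noteq> \<infinity>"
      using g_int by (intro nn_integral_PInf_AE) auto
    then show ?thesis
      by eventually_elim (auto intro!: summable_suminf_not_top g0)
  qed
  define w where "w t = (\<Sum>k. g k t)" for t
  have "integrable M w"
    unfolding w_def using g_int summ summ_int g0 by (intro integrable_suminf) auto
  \<comment> \<open>Sums of norms are bounded, rather than norms of sums, because this also gives
    absolute convergence.\<close>
  moreover have bound: "AE t in M. \<forall>n. (\<Sum>k<n. norm (f k t)) powr p \<le> w t"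
    using summ
  proof eventually_elim
    case (elim t)
    show ?case
    proof
      fix n
      have "norm (\<Sum>k<n. norm (f k t)) powr p \<le>
          (\<Sum>k<n. s k) powr (p - 1) * (\<Sum>k<n. norm (norm (f k t)) powr p / s k powr (p - 1))"
        using p s by (rule norm_sum_powr_le)
      also have "\<dots> \<le> 2 powr (p - 1) * (\<Sum>k<n. norm (norm (f k t)) powr p / s k powr (p - 1))"
        using sum_s[of n] p s
        by (intro mult_right_mono powr_mono2 sum_nonneg) (auto intro: less_imp_le)
      also have "\<dots> = (\<Sum>k<n. g k t)" by (simp add: g_def sum_distrib_left)
      also have "\<dots> \<le> w t"
        unfolding w_def using elim g0 by (intro sum_le_suminf) auto
      finally show "(\<Sum>k<n. norm (f k t)) powr p \<le> w t" by (simp add: sum_nonneg)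
    qed
  qed
  moreover have conv: "AE t in M. summable (\<lambda>k. f k t)"
    using bound
  proof eventually_elim
    case (elim t)
    have "(\<Sum>k<n. norm (f k t)) \<le> w t powr (1 / p)" for n
      using powr_mono2[of "1 / p", OF _ _ elim[rule_format, of n]] p
      by (simp add: powr_powr sum_nonneg)
    then show ?case
      by (intro summable_norm_cancel[OF summableI_nonneg_bounded]) auto
  qed
  moreover have part: "AE t in M. \<forall>n. norm (\<Sum>k<n. f k t) powr p \<le> w t"
    using bound
  proof eventually_elim
    case (elim t)
    have "norm (\<Sum>k<n. f k t) powr p \<le> (\<Sum>k<n. norm (f k t)) powr p" for n
      using p by (intro powr_mono2 norm_sum) auto
    then show ?case using elim by (blast intro: order_trans)
  qed
  moreover have "AE t in M. norm (\<Sum>k. f k t) powr p \<le> w t"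
    using part conv
  proof eventually_elim
    case (elim t)
    have "(\<lambda>n. norm (\<Sum>k<n. f k t) powr p) \<longlonglongrightarrow> norm (\<Sum>k. f k t) powr p"
      using p elim(2) by (intro tendsto_powr' tendsto_norm summable_LIMSEQ tendsto_const) auto
    then show ?case
      using elim(1) by (intro LIMSEQ_le_const2) auto
  qed
  ultimately show thesis using that by blast
qed

section \<open>The delta measure and test functions\<close>

text \<open>An rd-continuous function is continuous at every point of \<open>S\<close> that is
  neither in this set nor a maximum of \<open>S\<close>.\<close>

definition right_scattered :: "real set \<Rightarrow> real set" where
  "right_scattered S = {t \<in> S. (\<exists>s\<in>S. t < s) \<and> t < fwd_jump S t}"

lemma fwd_jump_le: "s \<in> S \<Longrightarrow> t < s \<Longrightarrow> fwd_jump S t \<le> s"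
  unfolding fwd_jump_def by (auto intro!: cInf_lower bdd_belowI[of _ t])

lemma fwd_jump_ge: "s \<in> S \<Longrightarrow> t < s \<Longrightarrow> t \<le> fwd_jump S t"
  unfolding fwd_jump_def by (auto intro!: cInf_greatest)

text \<open>The gaps between a right-scattered point and its jump are disjoint open intervals, and
  each contains a rational.\<close>

lemma countable_right_scattered: "countable (right_scattered S)"
proof -
  have "\<exists>q::rat. t < real_of_rat q \<and> real_of_rat q < fwd_jump S t" if "t \<in> right_scattered S" for t
    using that of_rat_dense by (auto simp: right_scattered_def)
  then obtain q :: "real \<Rightarrow> rat" where
    q: "\<And>t. t \<in> right_scattered S \<Longrightarrow> t < real_of_rat (q t) \<and> real_of_rat (q t) < fwd_jump S t"
    by metis
  have "real_of_rat (q t) < real_of_rat (q t')"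
    if "t \<in> right_scattered S" "t' \<in> right_scattered S" "t < t'" for t t'
    using q[OF that(1)] q[OF that(2)] fwd_jump_le[of t' S t] that by (auto simp: right_scattered_def)
  then have "inj_on q (right_scattered S)"
    by (intro inj_onI) (metis less_irrefl linorder_neqE_linordered_idom)
  then show ?thesis
    by (rule countableI')
qed

text \<open>On each side there is either a finite limit or a gap of \<open>S\<close> next to
  \<open>t\<close>. In a gap the one-sided filter is trivial and even the bound 0 holds; the ends of
  \<open>S\<close> count as gaps.\<close>

lemma rd_continuous_locally_bounded:
  fixes f :: "real \<Rightarrow> 'c::real_normed_vector"
  assumes rd: "rd_continuous S f" and t: "t \<in> S"
  shows "\<exists>B. eventually (\<lambda>s. norm (f s) \<le> B) (at t within S)"
proof -
  have lim: "\<exists>B. eventually (\<lambda>s. norm (f s) \<le> B) F" if "(f \<longlongrightarrow> l) F" for F l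
  proof -
    have "eventually (\<lambda>s. norm (f s) < norm l + 1) F"
      by (intro order_tendstoD(2)[OF tendsto_norm[OF that]]) simp
    then show ?thesis by (auto elim: eventually_mono intro!: exI[of _ "norm l + 1"])
  qed
  have right: "\<exists>B. eventually (\<lambda>s. norm (f s) \<le> B) (at t within S \<inter> {t<..})"
  proof (cases "(\<exists>s\<in>S. t < s) \<and> fwd_jump S t = t")
    case True
    then have "(f \<longlongrightarrow> f t) (at t within S)"
      using rd t by (auto simp: rd_continuous_def continuous_within)
    then have "(f \<longlongrightarrow> f t) (at t within S \<inter> {t<..})"
      by (rule tendsto_within_subset) auto
    then show ?thesis by (rule lim)
  next
    case False
    have "\<exists>u>t. S \<inter> {t<..<u} = {}"
    proof (cases "\<exists>s\<in>S. t < s")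
      case True
      then have "t < fwd_jump S t" using False fwd_jump_ge[of _ S t] by force
      then show ?thesis using fwd_jump_le[of _ S t] by (intro exI[of _ "fwd_jump S t"]) force
    qed (auto intro!: exI[of _ "t + 1"])
    then obtain u where u: "u > t" "S \<inter> {t<..<u} = {}" by auto
    then have "eventually (\<lambda>s. norm (f s) \<le> 0) (at t within S \<inter> {t<..})"
      unfolding eventually_at_topological by (intro exI[of _ "{..<u}"]) auto
    then show ?thesis ..
  qed
  have left: "\<exists>B. eventually (\<lambda>s. norm (f s) \<le> B) (at t within S \<inter> {..<t})"
  proof (cases "(\<exists>s\<in>S. s < t) \<and> bwd_jump S t = t")
    case True
    then have "\<exists>l. (f \<longlongrightarrow> l) (at t within S \<inter> {..<t})"
      using rd t by (auto simp: rd_continuous_def)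
    then show ?thesis using lim by blast
  next
    case False
    have "\<exists>u<t. S \<inter> {u<..<t} = {}"
    proof (cases "\<exists>s\<in>S. s < t")
      case True
      have up: "s \<le> bwd_jump S t" if "s \<in> S" "s < t" for s
        using that by (auto simp: bwd_jump_def intro!: cSup_upper bdd_aboveI[of _ t])
      have "bwd_jump S t \<le> t"
        using True by (auto simp: bwd_jump_def intro!: cSup_least)
      then have "bwd_jump S t < t" using False True by auto
      then show ?thesis using up by (intro exI[of _ "bwd_jump S t"]) force
    qed (auto intro!: exI[of _ "t - 1"])
    then obtain u where u: "u < t" "S \<inter> {u<..<t} = {}" by auto
    then have "eventually (\<lambda>s. norm (f s) \<le> 0) (at t within S \<inter> {..<t})"
      unfolding eventually_at_topological by (intro exI[of _ "{u<..}"]) auto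
    then show ?thesis ..
  qed
  have "at t within S = at t within (S - {t})" by (simp add: at_within_def)
  also have "S - {t} = (S \<inter> {..<t}) \<union> (S \<inter> {t<..})" by auto
  finally have *: "at t within S = sup (at t within (S \<inter> {..<t})) (at t within (S \<inter> {t<..}))"
    by (simp add: at_within_union)
  obtain B1 B2 where "eventually (\<lambda>s. norm (f s) \<le> B1) (at t within S \<inter> {..<t})"
    "eventually (\<lambda>s. norm (f s) \<le> B2) (at t within S \<inter> {t<..})"
    using left right by auto
  then have "eventually (\<lambda>s. norm (f s) \<le> max B1 B2) (at t within S)"
    unfolding * eventually_sup by (auto elim: eventually_mono)
  then show ?thesis ..
qed

text \<open>The local bound concerns punctured neighbourhoods, so \<open>norm (f t)\<close> is added
  to it before compactness is used.\<close>

lemma rd_continuous_bounded: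
  fixes f :: "real \<Rightarrow> 'c::real_normed_vector"
  assumes rd: "rd_continuous S f" and S: "compact S"
  obtains B where "\<And>t. t \<in> S \<Longrightarrow> norm (f t) \<le> B"
proof -
  have "\<exists>U B. open U \<and> t \<in> U \<and> (\<forall>s\<in>S \<inter> U. norm (f s) \<le> B)" if t: "t \<in> S" for t
  proof -
    obtain B where "eventually (\<lambda>s. norm (f s) \<le> B) (at t within S)"
      using rd_continuous_locally_bounded[OF rd t] by blast
    then obtain U where "open U" "t \<in> U" "\<forall>s\<in>U. s \<noteq> t \<longrightarrow> s \<in> S \<longrightarrow> norm (f s) \<le> B"
      unfolding eventually_at_topological by blast
    then show ?thesis
      by (intro exI[of _ U] exI[of _ "max B (norm (f t))"]) (auto simp: le_max_iff_disj)
  qed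
  then obtain U B where U: "\<And>t. t \<in> S \<Longrightarrow> open (U t) \<and> t \<in> U t"
    and B: "\<And>t s. t \<in> S \<Longrightarrow> s \<in> S \<Longrightarrow> s \<in> U t \<Longrightarrow> norm (f s) \<le> B t"
    by (metis IntI)
  obtain F where F: "F \<subseteq> S" "finite F" "S \<subseteq> (\<Union>t\<in>F. U t)"
    by (rule compactE_image[OF S, of S U]) (use U in auto)
  have "norm (f s) \<le> (\<Sum>t\<in>F. \<bar>B t\<bar>)" if s: "s \<in> S" for s
  proof -
    obtain t where t: "t \<in> F" "s \<in> U t" using F s by auto
    have "norm (f s) \<le> \<bar>B t\<bar>" using B[of t s] t F s by force
    also have "\<dots> \<le> (\<Sum>t\<in>F. \<bar>B t\<bar>)" using t F by (intro member_le_sum) auto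
    finally show ?thesis .
  qed
  then show thesis using that by blast
qed

section \<open>Measurability and integrability for the delta measure\<close>

lemma space_delta_borel: "space (delta_borel T a b) = T \<inter> {a..<b}"
  unfolding delta_borel_def by (rule space_extend_measure) auto

lemma space_delta_measure: "space (delta_measure T a b) = T \<inter> {a..<b}"
  by (simp add: delta_measure_def space_delta_borel)

lemma finite_delta_measure:
  assumes "closed T" "a \<in> T" "b \<in> T" "a \<le> b"
  shows "finite_measure (delta_measure T a b)"
proof
  have "emeasure (delta_borel T a b) (T \<inter> {a..<b}) = ennreal (b - a)"
    using assms by (intro emeasure_delta_borel) auto
  moreover have "T \<inter> {a..<b} \<in> sets (delta_borel T a b)"
    using sets.top[of "delta_borel T a b"] by (simp add: space_delta_borel)
  ultimately show "emeasure (delta_measure T a b) (space (delta_measure T a b)) \<noteq> \<infinity>"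
    by (simp add: delta_measure_def space_delta_borel)
qed

text \<open>The generating intervals have endpoints in the time scale, whereas \<open>x\<close> is
  arbitrary. For \<open>x \<le> b\<close>, cutting at \<open>x\<close> is the same as cutting at
  \<open>d\<close>, the first point of the time scale that is not below \<open>x\<close>.\<close>

lemma id_measurable_delta_borel:
  assumes T: "closed T" "a \<in> T" "b \<in> T" "a \<le> b"
  shows "(\<lambda>t. t) \<in> borel_measurable (delta_borel T a b)"
  unfolding borel_measurable_iff_less
proof
  fix x
  define I where "I = {(c, d). c \<in> ts_interval T a b \<and> d \<in> ts_interval T a b \<and> c \<le> d}"
  have sets: "T \<inter> {c..<d} \<in> sets (delta_borel T a b)"
    if "c \<in> ts_interval T a b" "d \<in> ts_interval T a b" "c \<le> d" for c d
  proof -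
    have "(\<lambda>(c, d). T \<inter> {c..<d}) ` I \<subseteq> Pow (T \<inter> {a..<b})" by (auto simp: I_def)
    then show ?thesis
      unfolding delta_borel_def I_def[symmetric] using that
      by (subst sets_extend_measure) (auto simp: I_def intro!: sigma_sets.Basic)
  qed
  define d where "d = Inf (ts_interval T a b \<inter> {x..})"
  show "{t \<in> space (delta_borel T a b). t < x} \<in> sets (delta_borel T a b)"
  proof (cases "x \<le> b")
    case True
    have ne: "ts_interval T a b \<inter> {x..} \<noteq> {}" using True T by auto
    have bdd: "bdd_below (ts_interval T a b \<inter> {x..})" by (auto intro: bdd_belowI[of _ x])
    have d: "d \<in> ts_interval T a b \<inter> {x..}"
      unfolding d_def using T by (intro closed_contains_Inf ne bdd closed_Int) auto
    have "d \<le> t" if "t \<in> T" "a \<le> t" "t \<le> b" "x \<le> t" for t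
      unfolding d_def using that bdd by (intro cInf_lower) auto
    then have "{t \<in> space (delta_borel T a b). t < x} = T \<inter> {a..<d}"
      using d by (fastforce simp: space_delta_borel)
    also have "\<dots> \<in> sets (delta_borel T a b)" using d T by (intro sets) auto
    finally show ?thesis .
  next
    case False
    then have "{t \<in> space (delta_borel T a b). t < x} = space (delta_borel T a b)"
      by (auto simp: space_delta_borel)
    then show ?thesis by (simp only: sets.top)
  qed
qed

text \<open>Cut off outside the right-dense points, \<open>f\<close> is Borel by continuity. It
  differs from the cut function at countably many points, and singletons are measurable as preimages
  under the identity.\<close>

lemma rd_continuous_measurable:
  fixes f :: "real \<Rightarrow> 'c::euclidean_space"
  assumes T: "closed T" "a \<in> T" "b \<in> T" "a \<le> b"
    and rd: "rd_continuous (ts_interval T a b) f"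
  shows "f \<in> borel_measurable (delta_measure T a b)"
proof -
  let ?S = "ts_interval T a b" and ?N = "delta_borel T a b"
  define A where "A = ?S \<inter> {..<b} - right_scattered ?S"
  have id: "(\<lambda>t. t) \<in> borel_measurable ?N" by (rule id_measurable_delta_borel[OF T])
  have "continuous_on A f"
    unfolding continuous_on_eq_continuous_within
  proof
    fix t assume t: "t \<in> A"
    then have "(\<exists>s\<in>?S. t < s)" using T by (auto simp: A_def)
    moreover from this have "fwd_jump ?S t = t"
      using t fwd_jump_ge[of _ ?S t] by (force simp: A_def right_scattered_def)
    ultimately have "continuous (at t within ?S) f"
      using rd t by (auto simp: rd_continuous_def A_def)
    then show "continuous (at t within A) f"
      by (rule continuous_within_subset) (auto simp: A_def)
  qed
  moreover have "A \<in> sets borel"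
  proof -
    have "right_scattered ?S \<in> sets borel"
      by (rule sets.countable[OF _ countable_right_scattered]) simp
    moreover have "T \<in> sets borel" using T by (intro borel_closed)
    ultimately show ?thesis unfolding A_def by (intro sets.Diff sets.Int) simp_all
  qed
  ultimately have "(\<lambda>x. indicator A x *\<^sub>R f x) \<in> borel_measurable borel"
    by (intro borel_measurable_continuous_on_indicator)
  from measurable_compose[OF id this]
  have "f \<in> borel_measurable ?N"
  proof (rule measurable_discrete_difference[where X = "right_scattered ?S \<inter> space ?N"])
    show "countable (right_scattered ?S \<inter> space ?N)"
      using countable_right_scattered by (rule countable_subset[rotated]) auto
    show "{x} \<in> sets ?N" if "x \<in> right_scattered ?S \<inter> space ?N" for x
    proof -
      have "(\<lambda>t. t) -` {x} \<inter> space ?N \<in> sets ?N" by (rule measurable_sets[OF id]) simp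
      also have "(\<lambda>t. t) -` {x} \<inter> space ?N = {x}" using that by auto
      finally show ?thesis .
    qed
    show "indicator A x *\<^sub>R f x = f x"
      if "x \<in> space ?N" "x \<notin> right_scattered ?S \<inter> space ?N" for x
      using that by (auto simp: A_def space_delta_borel)
  qed simp
  then show ?thesis unfolding delta_measure_def by (rule measurable_completion)
qed

lemma test_function_lp:
  fixes \<phi> :: "real \<Rightarrow> 'c::euclidean_space"
  assumes T: "closed T" "a \<in> T" "b \<in> T" "a \<le> b" and \<phi>: "test_function T a b \<phi>" and q: "0 \<le> q"
  shows "\<phi> \<in> lp_functions T a b q"
proof -
  have rd: "rd_continuous (ts_interval T a b) \<phi>"
    using \<phi> by (auto simp: test_function_def dest!: spec[of _ "0::nat"])
  note meas = rd_continuous_measurable[OF T rd]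
  obtain B where B: "\<And>t. t \<in> ts_interval T a b \<Longrightarrow> norm (\<phi> t) \<le> B"
    using rd_continuous_bounded[OF rd closed_Int_compact[OF T(1) compact_Icc]] by blast
  interpret finite_measure "delta_measure T a b" by (rule finite_delta_measure[OF T])
  have "integrable (delta_measure T a b) (\<lambda>t. norm (\<phi> t) powr q)"
  proof (rule integrable_const_bound[where B = "B powr q"])
    show "AE t in delta_measure T a b. norm (norm (\<phi> t) powr q) \<le> B powr q"
      using B q by (intro AE_I2) (auto simp: space_delta_measure intro!: powr_mono2)
  qed (use meas in measurable)
  then show ?thesis using meas by (simp add: lp_functions_def)
qed

section \<open>The Sobolev space\<close>

locale delta_interval =
  fixes T :: "real set" and a b p :: real
  assumes closed_T: "closed T" and a_in: "a \<in> T" and b_in: "b \<in> T" and ab: "a < b" and p: "1 < p"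
begin

section \<open>Integrable p-th powers and dual pairings\<close>

abbreviation "M \<equiv> delta_measure T a b"

abbreviation Lp :: "(real \<Rightarrow> 'c::euclidean_space) set" where
  "Lp \<equiv> lp_functions T a b p"

abbreviation cls :: "(real \<Rightarrow> 'c::euclidean_space) \<Rightarrow> (real \<Rightarrow> 'c) set" where
  "cls \<equiv> ae_class T a b p"

text \<open>The p-th power of the norm, kept without the root so that the contributions of
  \<open>u\<close> and \<open>g\<close> simply add.\<close>

definition J :: "(real \<Rightarrow> 'c::euclidean_space) \<Rightarrow> real" where
  "J u = (LINT t|M. norm (u t) powr p)"

lemma LpD: "u \<in> Lp \<Longrightarrow> u \<in> borel_measurable M" "u \<in> Lp \<Longrightarrow> integrable M (\<lambda>t. norm (u t) powr p)"
  and LpI: "u \<in> borel_measurable M \<Longrightarrow> integrable M (\<lambda>t. norm (u t) powr p) \<Longrightarrow> u \<in> Lp"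
  by (simp_all add: lp_functions_def)

lemma Lp_dominated:
  assumes "u \<in> borel_measurable M" "integrable M w" "AE t in M. norm (u t) powr p \<le> w t"
  shows "u \<in> Lp"
proof (rule LpI[OF assms(1)])
  show "integrable M (\<lambda>t. norm (u t) powr p)"
    by (rule Bochner_Integration.integrable_bound[OF assms(2)]) (use assms in auto)
qed

lemma J_nonneg: "0 \<le> J u"
  by (simp add: J_def)

lemma J_zero: "J (\<lambda>_. 0) = 0"
  by (simp add: J_def)

lemma J_scale: "J (\<lambda>t. c *\<^sub>R u t) = \<bar>c\<bar> powr p * J u"
  by (simp add: J_def powr_mult)

lemma lp_norm_powr: "lp_norm T a b p u powr p = J u"
  using p J_nonneg[of u] by (simp add: lp_norm_def J_def powr_powr)

lemma J_cong: "u \<in> Lp \<Longrightarrow> v \<in> Lp \<Longrightarrow> AE t in M. u t = v t \<Longrightarrow> J u = J v"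
  unfolding J_def by (intro integral_cong_AE borel_measurable_integrable LpD) auto

lemma Lp_zero: "(\<lambda>_. 0) \<in> Lp"
  by (simp add: lp_functions_def)

lemma Lp_scale: "u \<in> Lp \<Longrightarrow> (\<lambda>t. c *\<^sub>R u t) \<in> Lp"
  by (auto simp: lp_functions_def powr_mult)

text \<open>The weights stay free: taken equal they show closure under addition, taken just above
  two norms they give Minkowski's inequality in \<open>vnorm_add\<close>.\<close>

lemma J_add_le:
  assumes u: "u \<in> Lp" and v: "v \<in> Lp" and st: "0 < s" "0 < t"
  shows "(\<lambda>x. u x + v x) \<in> Lp"
    and "J (\<lambda>x. u x + v x) \<le> (s + t) powr (p - 1) * (J u / s powr (p - 1) + J v / t powr (p - 1))"
proof -
  let ?w = "\<lambda>x. (s + t) powr (p - 1) * (norm (u x) powr p / s powr (p - 1) + norm (v x) powr p / t powr (p - 1))"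
  have w: "integrable M ?w"
    by (intro integrable_mult_right Bochner_Integration.integrable_add integrable_divide LpD u v)
  show *: "(\<lambda>x. u x + v x) \<in> Lp"
    by (rule Lp_dominated[OF _ w]) (use LpD(1)[OF u] LpD(1)[OF v] norm_add_powr_le[OF p st] in auto)
  have "J (\<lambda>x. u x + v x) \<le> (LINT x|M. ?w x)"
    unfolding J_def by (intro integral_mono LpD(2)[OF *] w norm_add_powr_le p st)
  also have "\<dots> = (s + t) powr (p - 1) * (J u / s powr (p - 1) + J v / t powr (p - 1))"
    using LpD(2)[OF u] LpD(2)[OF v] by (simp add: J_def)
  finally show "J (\<lambda>x. u x + v x) \<le> (s + t) powr (p - 1) * (J u / s powr (p - 1) + J v / t powr (p - 1))" .
qed

lemma Lp_add: "u \<in> Lp \<Longrightarrow> v \<in> Lp \<Longrightarrow> (\<lambda>t. u t + v t) \<in> Lp"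
  by (rule J_add_le(1)[OF _ _ zero_less_one zero_less_one])

lemma J_uniformly_convex:
  assumes \<epsilon>: "0 < \<epsilon>"
  obtains C where "0 \<le> C" "\<And>u v :: real \<Rightarrow> 'c::euclidean_space. u \<in> Lp \<Longrightarrow> v \<in> Lp \<Longrightarrow>
    J (\<lambda>t. u t + (- 1) *\<^sub>R v t) \<le> \<epsilon> * (J u + J v) +
      C * ((J u + J v) / 2 - J (\<lambda>t. (1 / 2) *\<^sub>R (u t + v t)))"
proof -
  obtain C where C: "0 \<le> C" "\<And>x y :: 'c. norm (x - y) powr p \<le>
    \<epsilon> * (norm x powr p + norm y powr p) +
    C * ((norm x powr p + norm y powr p) / 2 - norm ((1 / 2) *\<^sub>R (x + y)) powr p)"
    using norm_powr_uniformly_convex[OF p \<epsilon>, where ?'c = 'c] by blast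
  have "J (\<lambda>t. u t + (- 1) *\<^sub>R v t) \<le> \<epsilon> * (J u + J v) +
      C * ((J u + J v) / 2 - J (\<lambda>t. (1 / 2) *\<^sub>R (u t + v t)))"
    if u: "u \<in> Lp" and v: "v \<in> Lp" for u v :: "real \<Rightarrow> 'c"
  proof -
    have ints: "integrable M (\<lambda>t. norm (u t) powr p)" "integrable M (\<lambda>t. norm (v t) powr p)"
      "integrable M (\<lambda>t. norm ((1 / 2) *\<^sub>R (u t + v t)) powr p)"
      by (intro LpD(2) Lp_scale Lp_add u v)+
    have "J (\<lambda>t. u t + (- 1) *\<^sub>R v t) \<le> (LINT t|M. \<epsilon> * (norm (u t) powr p + norm (v t) powr p) +
      C * ((norm (u t) powr p + norm (v t) powr p) / 2 - norm ((1 / 2) *\<^sub>R (u t + v t)) powr p))"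
      unfolding J_def
    proof (rule integral_mono)
      show "integrable M (\<lambda>t. norm (u t + (- 1) *\<^sub>R v t) powr p)"
        by (intro LpD Lp_add Lp_scale u v)
      show "integrable M (\<lambda>t. \<epsilon> * (norm (u t) powr p + norm (v t) powr p) +
        C * ((norm (u t) powr p + norm (v t) powr p) / 2 - norm ((1 / 2) *\<^sub>R (u t + v t)) powr p))"
        by (intro Bochner_Integration.integrable_add integrable_mult_right
            Bochner_Integration.integrable_diff integrable_divide ints)
      show "norm (u t + (- 1) *\<^sub>R v t) powr p \<le> \<epsilon> * (norm (u t) powr p + norm (v t) powr p) +
        C * ((norm (u t) powr p + norm (v t) powr p) / 2 - norm ((1 / 2) *\<^sub>R (u t + v t)) powr p)" for t
        using C(2)[of "u t" "v t"] by simp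
    qed
    also have "\<dots> = \<epsilon> * (J u + J v) + C * ((J u + J v) / 2 - J (\<lambda>t. (1 / 2) *\<^sub>R (u t + v t)))"
    proof -
      have "(LINT t|M. \<epsilon> * (f t + g t) + C * ((f t + g t) / 2 - h t)) =
          \<epsilon> * ((LINT t|M. f t) + (LINT t|M. g t)) +
          C * (((LINT t|M. f t) + (LINT t|M. g t)) / 2 - (LINT t|M. h t))"
        if "integrable M f" "integrable M g" "integrable M h" for f g h :: "real \<Rightarrow> real"
        using that by simp
      from this[OF ints] show ?thesis by (simp only: J_def)
    qed
    finally show ?thesis .
  qed
  with C(1) show thesis using that by blast
qed

text \<open>Young's inequality with its factors \<open>1 / p\<close> and \<open>1 / q\<close>
  enlarged to 1. Unlike a product of norms, this sum can serve as a pointwise majorant.\<close>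

lemma pairing_bound:
  assumes q: "q = p / (p - 1)"
  shows "norm (x \<bullet> y) \<le> norm x powr p + norm y powr q"
proof -
  have "norm (x \<bullet> y) \<le> norm x * norm y" using Cauchy_Schwarz_ineq2 by simp
  also have "\<dots> \<le> norm x powr p / p + norm y powr q / q"
    using p by (intro Youngs_inequality) (auto simp: q field_simps)
  also have "\<dots> \<le> norm x powr p / 1 + norm y powr q / 1"
    using p by (intro add_mono divide_left_mono) (auto simp: q field_simps)
  finally show ?thesis by simp
qed

lemma pairing_integrable:
  assumes u: "u \<in> Lp" and \<psi>: "\<psi> \<in> lp_functions T a b (p / (p - 1))"
  shows "integrable M (\<lambda>t. u t \<bullet> \<psi> t)"
proof (rule Bochner_Integration.integrable_bound)
  show "integrable M (\<lambda>t. norm (u t) powr p + norm (\<psi> t) powr (p / (p - 1)))"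
    using u \<psi> by (simp add: lp_functions_def)
  show "(\<lambda>t. u t \<bullet> \<psi> t) \<in> borel_measurable M"
    using u \<psi> by (simp add: lp_functions_def borel_measurable_inner)
  show "AE t in M. norm (u t \<bullet> \<psi> t) \<le> norm (norm (u t) powr p + norm (\<psi> t) powr (p / (p - 1)))"
    by (rule AE_I2) (simp add: pairing_bound[OF refl, unfolded real_norm_def])
qed

lemma test_function_Lq: "test_function T a b \<phi> \<Longrightarrow> \<phi> \<in> lp_functions T a b (p / (p - 1))"
  using closed_T a_in b_in ab p by (intro test_function_lp) auto

lemma pairing_limit:
  assumes u: "\<And>n. un n \<in> Lp" "u \<in> Lp" and \<psi>: "\<psi> \<in> lp_functions T a b (p / (p - 1))"
    and w: "integrable M w" and lim: "AE t in M. (\<lambda>n. un n t) \<longlonglongrightarrow> u t"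
    and bound: "AE t in M. \<forall>n. norm (un n t) powr p \<le> w t"
  shows "(\<lambda>n. LINT t|M. un n t \<bullet> \<psi> t) \<longlonglongrightarrow> (LINT t|M. u t \<bullet> \<psi> t)"
proof (rule integral_dominated_convergence)
  show "(\<lambda>t. u t \<bullet> \<psi> t) \<in> borel_measurable M" "\<And>n. (\<lambda>t. un n t \<bullet> \<psi> t) \<in> borel_measurable M"
    using u \<psi> by (simp_all add: lp_functions_def borel_measurable_inner)
  show "integrable M (\<lambda>t. w t + norm (\<psi> t) powr (p / (p - 1)))"
    using w \<psi> by (simp add: lp_functions_def)
  show "AE t in M. (\<lambda>n. un n t \<bullet> \<psi> t) \<longlonglongrightarrow> u t \<bullet> \<psi> t"
    using lim by eventually_elim (intro tendsto_inner tendsto_const)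
  show "AE t in M. norm (un n t \<bullet> \<psi> t) \<le> w t + norm (\<psi> t) powr (p / (p - 1))" for n
    using bound
  proof eventually_elim
    case (elim t)
    then show ?case using pairing_bound[OF refl, of "un n t" "\<psi> t"] by (meson add_right_mono order_trans)
  qed
qed

lemma J_limit:
  assumes u: "\<And>n. un n \<in> Lp" "u \<in> Lp"
    and w: "integrable M w" and lim: "AE t in M. (\<lambda>n. un n t) \<longlonglongrightarrow> u t"
    and bound: "AE t in M. \<forall>n. norm (un n t) powr p \<le> w t"
  shows "(\<lambda>n. J (\<lambda>t. un n t + (- 1) *\<^sub>R u t)) \<longlonglongrightarrow> 0"
proof -
  have "(\<lambda>n. LINT t|M. norm (un n t + (- 1) *\<^sub>R u t) powr p) \<longlonglongrightarrow> (LINT t|M. 0)"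
  proof (rule integral_dominated_convergence)
    show "(\<lambda>t. norm (un n t + (- 1) *\<^sub>R u t) powr p) \<in> borel_measurable M" for n
      by (intro borel_measurable_integrable LpD Lp_add Lp_scale u)
    \<comment> \<open>The factor is \<open>(1 + 1) powr (p - 1)\<close>, from
      \<open>norm_add_powr_le\<close> with unit weights.\<close>
    show "integrable M (\<lambda>t. 2 powr (p - 1) * (w t + norm (u t) powr p))"
      using w LpD(2)[OF u(2)] by simp
    show "AE t in M. (\<lambda>n. norm (un n t + (- 1) *\<^sub>R u t) powr p) \<longlonglongrightarrow> 0"
      using lim
    proof eventually_elim
      case (elim t)
      have "(\<lambda>n. norm (un n t + (- 1) *\<^sub>R u t) powr p) \<longlonglongrightarrow> norm (u t + (- 1) *\<^sub>R u t) powr p"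
        using p by (intro tendsto_powr' tendsto_intros elim) auto
      then show ?case by simp
    qed
    show "AE t in M. norm (norm (un n t + (- 1) *\<^sub>R u t) powr p) \<le> 2 powr (p - 1) * (w t + norm (u t) powr p)" for n
      using bound
    proof eventually_elim
      case (elim t)
      have "norm (un n t + (- 1) *\<^sub>R u t) powr p \<le> 2 powr (p - 1) * (norm (un n t) powr p + norm (u t) powr p)"
        using norm_add_powr_le[OF p zero_less_one zero_less_one, of "un n t" "(- 1) *\<^sub>R u t"] by simp
      also have "\<dots> \<le> 2 powr (p - 1) * (w t + norm (u t) powr p)"
        using elim by (intro mult_left_mono add_right_mono) auto
      finally show ?case by simp
    qed
  qed simp
  then show ?thesis by (simp add: J_def)
qed

end

locale right_sobolev = delta_interval +
  fixes \<alpha> :: real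
begin

abbreviation weak :: "(real \<Rightarrow> 'c::euclidean_space) \<Rightarrow> (real \<Rightarrow> 'c) \<Rightarrow> bool" where
  "weak \<equiv> weak_right_deriv T a b \<alpha> p"

section \<open>The graph of the weak derivative as a closed linear relation\<close>

lemma weak_Lp: "weak u g \<Longrightarrow> g \<in> Lp"
  by (simp add: weak_right_deriv_def)

lemma weak_zero: "weak (\<lambda>_. 0) (\<lambda>_. 0)"
  by (simp add: weak_right_deriv_def Lp_zero)

lemma weak_add:
  assumes "u \<in> Lp" "v \<in> Lp" "weak u g" "weak v h"
  shows "weak (\<lambda>t. u t + v t) (\<lambda>t. g t + h t)"
  using assms unfolding weak_right_deriv_def
  by (auto simp: Lp_add inner_add_left pairing_integrable test_function_Lq)

lemma weak_scale:
  assumes "weak u g"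
  shows "weak (\<lambda>t. c *\<^sub>R u t) (\<lambda>t. c *\<^sub>R g t)"
  using assms unfolding weak_right_deriv_def by (auto simp: Lp_scale)

lemma weak_cong:
  fixes u v g h :: "real \<Rightarrow> 'c::euclidean_space"
  assumes R: "weak u g" and u: "u \<in> Lp" "v \<in> Lp" "AE t in M. v t = u t"
    and h: "h \<in> Lp" "AE t in M. h t = g t"
  shows "weak v h"
  unfolding weak_right_deriv_def
proof (intro conjI allI impI h(1), elim conjE)
  fix \<phi> \<psi> :: "real \<Rightarrow> 'c"
  assume \<phi>: "test_function T a b \<phi>" and \<psi>: "\<psi> \<in> lp_functions T a b (p / (p - 1))"
    and D: "AE t in M. has_left_RL_deriv T a b \<alpha> \<phi> t (\<psi> t)"
  have "(LINT t|M. v t \<bullet> \<psi> t) = (LINT t|M. u t \<bullet> \<psi> t)"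
    using u(3) by (intro integral_cong_AE borel_measurable_integrable pairing_integrable u \<psi>) auto
  also have "\<dots> = (LINT t|M. g t \<bullet> \<phi> t)" using R \<phi> \<psi> D by (auto simp: weak_right_deriv_def)
  also have "\<dots> = (LINT t|M. h t \<bullet> \<phi> t)"
    using h(2) by (intro integral_cong_AE borel_measurable_integrable pairing_integrable h(1)
        weak_Lp[OF R] test_function_Lq \<phi>) auto
  finally show "(LINT t|M. v t \<bullet> \<psi> t) = (LINT t|M. h t \<bullet> \<phi> t)" .
qed

lemma weak_limit:
  fixes u g :: "real \<Rightarrow> 'c::euclidean_space"
  assumes R: "\<And>n. weak (un n) (gn n)" and u: "\<And>n. un n \<in> Lp" "u \<in> Lp" and g: "g \<in> Lp"
    and w: "integrable M w" "AE t in M. (\<lambda>n. un n t) \<longlonglongrightarrow> u t" "AE t in M. \<forall>n. norm (un n t) powr p \<le> w t"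
    and v: "integrable M v" "AE t in M. (\<lambda>n. gn n t) \<longlonglongrightarrow> g t" "AE t in M. \<forall>n. norm (gn n t) powr p \<le> v t"
  shows "weak u g"
  unfolding weak_right_deriv_def
proof (intro conjI allI impI g, elim conjE)
  fix \<phi> \<psi> :: "real \<Rightarrow> 'c"
  assume \<phi>: "test_function T a b \<phi>" and \<psi>: "\<psi> \<in> lp_functions T a b (p / (p - 1))"
    and D: "AE t in M. has_left_RL_deriv T a b \<alpha> \<phi> t (\<psi> t)"
  have "(LINT t|M. un n t \<bullet> \<psi> t) = (LINT t|M. gn n t \<bullet> \<phi> t)" for n
    using R[of n] \<phi> \<psi> D by (auto simp: weak_right_deriv_def)
  then have "(\<lambda>n. LINT t|M. un n t \<bullet> \<psi> t) \<longlonglongrightarrow> (LINT t|M. g t \<bullet> \<phi> t)"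
    using pairing_limit[OF weak_Lp[OF R] g test_function_Lq[OF \<phi>] v] by simp
  with pairing_limit[OF u \<psi> w] show "(LINT t|M. u t \<bullet> \<psi> t) = (LINT t|M. g t \<bullet> \<phi> t)"
    by (rule LIMSEQ_unique)
qed

abbreviation S :: "(real \<Rightarrow> 'c::euclidean_space) set nspace" where
  "S \<equiv> right_sobolev_space T a b \<alpha> p (weak_right_deriv T a b \<alpha> p)"

section \<open>Almost-everywhere classes and their operations\<close>

lemma in_cls: "u \<in> Lp \<Longrightarrow> u \<in> cls u"
  by (simp add: ae_class_def)

lemma cls_eq: "AE t in M. u t = v t \<Longrightarrow> cls u = cls v"
proof -
  assume *: "AE t in M. u t = v t"
  have "(AE t in M. w t = u t) \<longleftrightarrow> (AE t in M. w t = v t)" for w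
    using * by (intro eventually_subst) (auto elim: eventually_mono)
  then show ?thesis by (simp add: ae_class_def)
qed

lemma cls_eqD: "u \<in> Lp \<Longrightarrow> cls u = cls v \<Longrightarrow> AE t in M. u t = v t"
  using in_cls[of u] by (simp add: ae_class_def)

lemma pts_S: "pts S = {cls u | u. u \<in> Lp \<and> (\<exists>g. weak u g)}"
  and vzero_S: "vzero S = cls (\<lambda>_. 0)"
  by (simp_all add: right_sobolev_space_def)

lemma ptsE:
  assumes "U \<in> pts S"
  obtains u g where "U = cls u" "u \<in> Lp" "weak u g"
  using assms unfolding pts_S by blast

lemma cls_in_pts: "u \<in> Lp \<Longrightarrow> weak u g \<Longrightarrow> cls u \<in> pts S"
  unfolding pts_S by blast

lemma vadd_cls:
  assumes "u \<in> Lp" "v \<in> Lp"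
  shows "vadd S (cls u) (cls v) = cls (\<lambda>t. u t + v t)"
proof -
  have "(\<exists>u'\<in>cls u. \<exists>v'\<in>cls v. AE t in M. w t = u' t + v' t) \<longleftrightarrow> (AE t in M. w t = u t + v t)" for w
  proof
    assume "\<exists>u'\<in>cls u. \<exists>v'\<in>cls v. AE t in M. w t = u' t + v' t"
    then obtain u' v' where "AE t in M. u' t = u t" "AE t in M. v' t = v t" "AE t in M. w t = u' t + v' t"
      by (auto simp: ae_class_def)
    then show "AE t in M. w t = u t + v t" by eventually_elim simp
  qed (use assms in_cls in blast)
  then show ?thesis by (simp add: right_sobolev_space_def ae_class_def)
qed

lemma vscale_cls:
  assumes "u \<in> Lp"
  shows "vscale S c (cls u) = cls (\<lambda>t. c *\<^sub>R u t)"
proof -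
  have "(\<exists>u'\<in>cls u. AE t in M. w t = c *\<^sub>R u' t) \<longleftrightarrow> (AE t in M. w t = c *\<^sub>R u t)" for w
  proof
    assume "\<exists>u'\<in>cls u. AE t in M. w t = c *\<^sub>R u' t"
    then obtain u' where "AE t in M. u' t = u t" "AE t in M. w t = c *\<^sub>R u' t"
      by (auto simp: ae_class_def)
    then show "AE t in M. w t = c *\<^sub>R u t" by eventually_elim simp
  qed (use assms in_cls in blast)
  then show ?thesis by (simp add: right_sobolev_space_def ae_class_def)
qed

lemma vdiff_cls:
  assumes "u \<in> Lp" "v \<in> Lp"
  shows "vdiff S (cls u) (cls v) = cls (\<lambda>t. u t + (- 1) *\<^sub>R v t)"
  using assms by (simp only: vscale_cls vadd_cls Lp_scale)

section \<open>The quotient norm\<close>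

lemma vnorm_S: "vnorm S U = Inf {(J u + J g) powr (1 / p) | u g. u \<in> U \<and> weak u g}"
  by (simp add: right_sobolev_space_def lp_norm_powr)

lemma vnorm_bdd: "bdd_below {(J u + J g) powr (1 / p) | u g. u \<in> U \<and> weak u g}"
  by (rule bdd_belowI[of _ 0]) auto

lemma vnorm_set_nonempty:
  assumes "U \<in> pts S"
  shows "{(J u + J g) powr (1 / p) | u g. u \<in> U \<and> weak u g} \<noteq> {}"
proof -
  obtain u g where "U = cls u" "u \<in> Lp" "weak u g" using assms by (rule ptsE)
  then show ?thesis using in_cls by blast
qed

lemma vnorm_nonneg:
  assumes "U \<in> pts S"
  shows "0 \<le> vnorm S U"
  unfolding vnorm_S by (rule cInf_greatest[OF vnorm_set_nonempty[OF assms]]) auto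

lemma vnorm_le: "u \<in> Lp \<Longrightarrow> weak u g \<Longrightarrow> vnorm S (cls u) \<le> (J u + J g) powr (1 / p)"
  unfolding vnorm_S using in_cls by (intro cInf_lower vnorm_bdd) blast

lemma vnorm_powr_le:
  assumes "u \<in> Lp" "weak u g"
  shows "vnorm S (cls u) powr p \<le> J u + J g"
  using powr_mono2[OF _ vnorm_nonneg[OF cls_in_pts[OF assms]] vnorm_le[OF assms], of p] p
  by (simp add: powr_powr J_nonneg)

lemma vnorm_leI:
  assumes "u \<in> Lp" "weak u g" "J u + J g \<le> r powr p" "0 \<le> r"
  shows "vnorm S (cls u) \<le> r"
proof -
  have "(J u + J g) powr (1 / p) \<le> (r powr p) powr (1 / p)"
    using assms p by (intro powr_mono2) (auto simp: J_nonneg)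
  then show ?thesis using vnorm_le[OF assms(1,2)] assms(4) p by (simp add: powr_powr)
qed

text \<open>Near-minimisers stand in for a minimiser. The member of \<open>U\<close> that is found
  becomes the representative, since a class is generated by each of its members.\<close>

lemma vnorm_approx:
  assumes U: "U \<in> pts S" and r: "vnorm S U < r"
  obtains u g where "U = cls u" "u \<in> Lp" "weak u g" "J u + J g < r powr p"
proof -
  obtain u g where u: "u \<in> U" "weak u g" "(J u + J g) powr (1 / p) < r"
    using cInf_lessD[OF vnorm_set_nonempty[OF U] r[unfolded vnorm_S]] by auto
  obtain u0 where u0: "U = cls u0" using U by (auto simp: pts_S)
  have "u \<in> Lp" "U = cls u"
    using u(1) cls_eq[of u u0] by (auto simp: u0 ae_class_def)
  moreover have "((J u + J g) powr (1 / p)) powr p < r powr p"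
    using u(3) p by (intro powr_less_mono2) auto
  then have "J u + J g < r powr p" using p J_nonneg by (simp add: powr_powr)
  ultimately show thesis using u(2) that by blast
qed

lemma vnorm_add:
  assumes U: "U \<in> pts S" and V: "V \<in> pts S"
  shows "vnorm S (vadd S U V) \<le> vnorm S U + vnorm S V"
proof (rule field_le_epsilon)
  fix e :: real assume e: "e > 0"
  \<comment> \<open>Strictly above the norms, these numbers admit near-minimisers and are positive
    even for zero classes. As weights they collapse the bound to
    \<open>(s + t) powr p\<close>.\<close>
  define s t where "s = vnorm S U + e / 2" and "t = vnorm S V + e / 2"
  have st: "s > 0" "t > 0" using vnorm_nonneg[OF U] vnorm_nonneg[OF V] e by (auto simp: s_def t_def)
  obtain u g where u: "U = cls u" "u \<in> Lp" "weak u g" "J u + J g < s powr p"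
    using vnorm_approx[OF U, of s] e by (auto simp: s_def)
  obtain v h where v: "V = cls v" "v \<in> Lp" "weak v h" "J v + J h < t powr p"
    using vnorm_approx[OF V, of t] e by (auto simp: t_def)
  have "J (\<lambda>x. u x + v x) + J (\<lambda>x. g x + h x) \<le>
      (s + t) powr (p - 1) * (J u / s powr (p - 1) + J v / t powr (p - 1)) +
      (s + t) powr (p - 1) * (J g / s powr (p - 1) + J h / t powr (p - 1))"
    using u v st weak_Lp by (intro add_mono J_add_le) blast+
  also have "\<dots> = (s + t) powr (p - 1) * ((J u + J g) / s powr (p - 1) + (J v + J h) / t powr (p - 1))"
    by (simp add: add_divide_distrib algebra_simps)
  also have "\<dots> \<le> (s + t) powr (p - 1) * (s powr p / s powr (p - 1) + t powr p / t powr (p - 1))"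
    using u v by (intro mult_left_mono add_mono divide_right_mono) auto
  also have "\<dots> = (s + t) powr p"
    using st by (simp add: powr_diff)
  finally have "vnorm S (vadd S U V) \<le> s + t"
    unfolding u(1) v(1) vadd_cls[OF u(2) v(2)] using st u v
    by (intro vnorm_leI[OF Lp_add weak_add]) auto
  then show "vnorm S (vadd S U V) \<le> vnorm S U + vnorm S V + e" by (simp add: s_def t_def)
qed

lemma vscale_closed:
  assumes "U \<in> pts S"
  shows "vscale S c U \<in> pts S"
proof -
  obtain u g where u: "U = cls u" "u \<in> Lp" "weak u g" using assms by (rule ptsE)
  show ?thesis
    unfolding u(1) vscale_cls[OF u(2)] by (rule cls_in_pts[OF Lp_scale weak_scale]) (fact u)+
qed

lemma vnorm_scale_le:
  assumes U: "U \<in> pts S"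
  shows "vnorm S (vscale S c U) \<le> \<bar>c\<bar> * vnorm S U"
proof -
  have *: "vnorm S (vscale S c U) \<le> \<bar>c\<bar> * r" if r: "vnorm S U < r" for r
  proof -
    obtain u g where u: "U = cls u" "u \<in> Lp" "weak u g" "J u + J g < r powr p"
      using vnorm_approx[OF U r] .
    have r0: "r \<ge> 0" using vnorm_nonneg[OF U] r by simp
    have "J (\<lambda>t. c *\<^sub>R u t) + J (\<lambda>t. c *\<^sub>R g t) = \<bar>c\<bar> powr p * (J u + J g)"
      by (simp add: J_scale distrib_left)
    also have "\<dots> \<le> \<bar>c\<bar> powr p * r powr p" using u by (intro mult_left_mono) auto
    also have "\<dots> = (\<bar>c\<bar> * r) powr p" using r0 by (simp add: powr_mult)
    finally show ?thesis
      unfolding u(1) vscale_cls[OF u(2)] using u r0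
      by (intro vnorm_leI[OF Lp_scale weak_scale]) auto
  qed
  have "(\<lambda>n. \<bar>c\<bar> * (vnorm S U + inverse (real (Suc n)))) \<longlonglongrightarrow> \<bar>c\<bar> * vnorm S U"
    by (intro tendsto_mult tendsto_const LIMSEQ_inverse_real_of_nat_add)
  then show ?thesis
    by (rule LIMSEQ_le_const) (auto intro!: exI[of _ 0] *)
qed

lemma vnorm_scale:
  assumes U: "U \<in> pts S"
  shows "vnorm S (vscale S c U) = \<bar>c\<bar> * vnorm S U"
proof (cases "c = 0")
  case True
  then show ?thesis
    using vnorm_scale_le[OF U, of c] vnorm_nonneg[OF vscale_closed[OF U, of c]] by simp
next
  case False
  obtain u where u: "U = cls u" "u \<in> Lp" using U by (rule ptsE)
  have "vscale S (1 / c) (vscale S c U) = U"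
    using u False by (simp add: vscale_cls Lp_scale)
  then have "vnorm S U \<le> \<bar>1 / c\<bar> * vnorm S (vscale S c U)"
    using vnorm_scale_le[OF vscale_closed[OF U, of c], of "1 / c"] by simp
  then show ?thesis using vnorm_scale_le[OF U, of c] False by (simp add: field_simps)
qed

lemma vnorm_eq_zero_iff:
  assumes U: "U \<in> pts S"
  shows "vnorm S U = 0 \<longleftrightarrow> U = vzero S"
proof
  assume 0: "vnorm S U = 0"
  obtain u where u: "U = cls u" "u \<in> Lp" using U by (rule ptsE)
  \<comment> \<open>The near-minimiser may be another representative, but \<open>J\<close> depends
    on the class only, so one fixed \<open>u\<close> is bounded by every positive
    \<open>r\<close>.\<close>
  have "J u \<le> r" if r: "r > 0" for r
  proof -
    have "vnorm S U < r powr (1 / p)" using 0 r by simp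
    then obtain v g where v: "U = cls v" "v \<in> Lp" "weak v g" "J v + J g < (r powr (1 / p)) powr p"
      by (rule vnorm_approx[OF U])
    have "cls u = cls v" using u(1) v(1) by (rule trans[OF sym])
    then have "J u = J v" using u(2) v(2) by (intro J_cong cls_eqD)
    then show ?thesis using v(4) J_nonneg[of g] r p by (simp add: powr_powr)
  qed
  then have "J u \<le> 0" by (rule field_le_epsilon[where y = 0, simplified])
  then have "J u = 0" using J_nonneg[of u] by simp
  then have "AE t in M. norm (u t) powr p = 0"
    unfolding J_def by (subst (asm) integral_nonneg_eq_0_iff_AE[OF LpD(2)[OF u(2)]]) auto
  then have "AE t in M. u t = 0" by eventually_elim simp
  then show "U = vzero S" unfolding u(1) vzero_S by (rule cls_eq)
next
  assume 0: "U = vzero S"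
  have "vnorm S U \<le> 0"
    unfolding 0 vzero_S by (rule vnorm_leI[OF Lp_zero weak_zero]) (simp_all add: J_zero)
  then show "vnorm S U = 0" using vnorm_nonneg[OF U] by simp
qed

lemma sobolev_real_nspace: "real_nspace (S :: (real \<Rightarrow> 'c::euclidean_space) set nspace)"
proof
  fix U V W :: "(real \<Rightarrow> 'c) set" and c d :: real
  show "vzero S \<in> pts S"
    unfolding vzero_S by (rule cls_in_pts[OF Lp_zero weak_zero])
  assume U: "U \<in> pts S"
  then obtain u g where u: "U = cls u" "u \<in> Lp" "weak u g" by (rule ptsE)
  show "vscale S c U \<in> pts S" using U by (rule vscale_closed)
  show "vadd S U (vzero S) = U" "vadd S U (vscale S (- 1) U) = vzero S"
    "vscale S (c + d) U = vadd S (vscale S c U) (vscale S d U)"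
    "vscale S c (vscale S d U) = vscale S (c * d) U" "vscale S 1 U = U"
    using u Lp_scale[of u "- 1"]
    by (simp_all add: vzero_S vadd_cls vscale_cls Lp_zero Lp_scale Lp_add scaleR_add_left)
  show "0 \<le> vnorm S U" "vnorm S U = 0 \<longleftrightarrow> U = vzero S" "vnorm S (vscale S c U) = \<bar>c\<bar> * vnorm S U"
    using U by (rule vnorm_nonneg vnorm_eq_zero_iff vnorm_scale)+
  assume V: "V \<in> pts S"
  then obtain v h where v: "V = cls v" "v \<in> Lp" "weak v h" by (rule ptsE)
  show "vadd S U V \<in> pts S"
    unfolding u(1) v(1) vadd_cls[OF u(2) v(2)]
    by (rule cls_in_pts[OF Lp_add weak_add]) (fact u v)+
  show "vadd S U V = vadd S V U"
    using u v by (simp add: vadd_cls add.commute)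
  show "vscale S c (vadd S U V) = vadd S (vscale S c U) (vscale S c V)"
    using u v by (simp add: vadd_cls vscale_cls Lp_scale Lp_add scaleR_add_right)
  show "vnorm S (vadd S U V) \<le> vnorm S U + vnorm S V"
    using U V by (rule vnorm_add)
  assume W: "W \<in> pts S"
  then obtain w where w: "W = cls w" "w \<in> Lp" by (rule ptsE)
  show "vadd S (vadd S U V) W = vadd S U (vadd S V W)"
    using u v w by (simp add: vadd_cls Lp_add add.assoc)
qed

section \<open>Completeness and uniform convexity of the Sobolev space\<close>

lemma sobolev_complete:
  fixes U :: "nat \<Rightarrow> (real \<Rightarrow> 'c::euclidean_space) set"
  assumes U: "\<And>n. U n \<in> pts S"
    and fast: "\<And>n. vnorm S (vdiff S (U (Suc n)) (U n)) \<le> (1 / 2) ^ n"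
  shows "\<exists>V\<in>pts S. (\<lambda>n. vnorm S (vdiff S (U n) V)) \<longlonglongrightarrow> 0"
proof -
  interpret real_nspace "S :: (real \<Rightarrow> 'c) set nspace" by (rule sobolev_real_nspace)
  obtain u0 g0 where u0: "U 0 = cls u0" "u0 \<in> Lp" "weak u0 g0" using U by (rule ptsE)
  \<comment> \<open>Derivatives are chosen for the increments: being possibly non-unique,
    derivatives chosen for the terms \<open>U n\<close> separately need not be close to each other.
    The factor 2 provides the strict inequality that a near-minimiser requires.\<close>
  have "\<exists>d h. vdiff S (U (Suc n)) (U n) = cls d \<and> d \<in> Lp \<and> weak d h \<and>
      J d + J h < (2 * (1 / 2) ^ n) powr p" for n
  proof -
    have "vnorm S (vdiff S (U (Suc n)) (U n)) < 2 * (1 / 2) ^ n"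
      by (rule le_less_trans[OF fast]) simp
    then obtain d h where "vdiff S (U (Suc n)) (U n) = cls d" "d \<in> Lp" "weak d h"
        "J d + J h < (2 * (1 / 2) ^ n) powr p"
      by (rule vnorm_approx[OF diff_closed[OF U U]])
    then show ?thesis by blast
  qed
  then obtain d h where dh: "\<And>n. vdiff S (U (Suc n)) (U n) = cls (d n)" "\<And>n. d n \<in> Lp"
    "\<And>n. weak (d n) (h n)" "\<And>n. J (d n) + J (h n) < (2 * (1 / 2) ^ n) powr p"
    by metis
  have h: "h n \<in> Lp" for n using weak_Lp[OF dh(3)] .
  have J_le: "J (d n) \<le> (2 * (1 / 2) ^ n) powr p" "J (h n) \<le> (2 * (1 / 2) ^ n) powr p" for n
    using dh(4)[of n] J_nonneg[of "d n"] J_nonneg[of "h n"] by auto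
  define dS hS where "dS n t = (\<Sum>k<n. d k t)" and "hS n t = (\<Sum>k<n. h k t)" for n t
  define D H where "D t = (\<Sum>k. d k t)" and "H t = (\<Sum>k. h k t)" for t
  obtain w where w: "integrable M w" "AE t in M. summable (\<lambda>k. d k t)"
    "AE t in M. \<forall>n. norm (dS n t) powr p \<le> w t" "AE t in M. norm (D t) powr p \<le> w t"
    by (rule Lp_series_dominated[OF p LpD[OF dh(2)] J_le(1)[unfolded J_def] zero_le_numeral])
      (rule that, simp_all add: dS_def D_def)
  obtain v where v: "integrable M v" "AE t in M. summable (\<lambda>k. h k t)"
    "AE t in M. \<forall>n. norm (hS n t) powr p \<le> v t" "AE t in M. norm (H t) powr p \<le> v t"
    by (rule Lp_series_dominated[OF p LpD[OF h] J_le(2)[unfolded J_def] zero_le_numeral])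
      (rule that, simp_all add: hS_def H_def)
  have dS: "dS n \<in> Lp \<and> weak (dS n) (hS n)" for n
  proof (induction n)
    case 0
    then show ?case using Lp_zero weak_zero by (simp add: dS_def[abs_def] hS_def[abs_def])
  next
    case (Suc n)
    have "dS (Suc n) = (\<lambda>t. dS n t + d n t)" "hS (Suc n) = (\<lambda>t. hS n t + h n t)"
      by (simp_all add: dS_def hS_def fun_eq_iff)
    then show ?case using Suc dh(2,3)[of n] by (simp add: Lp_add weak_add)
  qed
  then have hS: "hS n \<in> Lp" for n using weak_Lp by blast
  have D: "D \<in> Lp"
    by (rule Lp_dominated[OF _ w(1,4)]) (unfold D_def, intro borel_measurable_suminf LpD(1) dh(2))
  have H: "H \<in> Lp"
    by (rule Lp_dominated[OF _ v(1,4)]) (unfold H_def, intro borel_measurable_suminf LpD(1) h)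
  have lim: "AE t in M. (\<lambda>n. dS n t) \<longlonglongrightarrow> D t" "AE t in M. (\<lambda>n. hS n t) \<longlonglongrightarrow> H t"
    unfolding dS_def D_def hS_def H_def
    using w(2) v(2) by (auto elim: eventually_mono intro: summable_LIMSEQ)
  have DH: "weak D H"
    using dS by (intro weak_limit[OF _ _ D H w(1) lim(1) w(3) v(1) lim(2) v(3)]) auto
  have U_eq: "U n = cls (\<lambda>t. u0 t + dS n t)" for n
  proof (induction n)
    case 0
    then show ?case by (simp add: u0 dS_def)
  next
    case (Suc n)
    have "U (Suc n) = vadd S (U n) (cls (d n))"
      using add_diff_cancel[OF U[of "Suc n"] U[of n]] by (simp only: dh(1))
    also have "\<dots> = cls (\<lambda>t. (u0 t + dS n t) + d n t)"
      unfolding Suc using dS dh(2) u0(2) by (intro vadd_cls Lp_add) auto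
    also have "(\<lambda>t. (u0 t + dS n t) + d n t) = (\<lambda>t. u0 t + dS (Suc n) t)"
      by (simp add: dS_def fun_eq_iff)
    finally show ?case .
  qed
  define V where "V = cls (\<lambda>t. u0 t + D t)"
  have "V \<in> pts S"
    unfolding V_def by (rule cls_in_pts[OF Lp_add weak_add]) (fact u0 D DH)+
  moreover have "(\<lambda>n. vnorm S (vdiff S (U n) V)) \<longlonglongrightarrow> 0"
  proof (rule tendsto_sandwich)
    let ?E = "\<lambda>n. J (\<lambda>t. dS n t + (- 1) *\<^sub>R D t) + J (\<lambda>t. hS n t + (- 1) *\<^sub>R H t)"
    \<comment> \<open>The starting function \<open>u0\<close> cancels, so the limit of the
      increments alone controls the distance.\<close>
    have diff: "vdiff S (U n) V = cls (\<lambda>t. dS n t + (- 1) *\<^sub>R D t)" for n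
      unfolding U_eq V_def using u0(2) dS D by (subst vdiff_cls) (auto simp: Lp_add)
    show "\<forall>\<^sub>F n in sequentially. 0 \<le> vnorm S (vdiff S (U n) V)"
      using U \<open>V \<in> pts S\<close> by (intro always_eventually allI vnorm_nonneg diff_closed)
    show "\<forall>\<^sub>F n in sequentially. vnorm S (vdiff S (U n) V) \<le> ?E n powr (1 / p)"
      unfolding diff using dS D DH
      by (intro always_eventually allI vnorm_le Lp_add weak_add Lp_scale weak_scale) auto
    have "?E \<longlonglongrightarrow> 0 + 0"
      using dS hS by (intro tendsto_add J_limit[OF _ D w(1) lim(1) w(3)] J_limit[OF _ H v(1) lim(2) v(3)]) auto
    then have "(\<lambda>n. ?E n powr (1 / p)) \<longlonglongrightarrow> 0 powr (1 / p)"
      using p by (intro tendsto_powr' tendsto_const) (auto simp: J_nonneg)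
    then show "(\<lambda>n. ?E n powr (1 / p)) \<longlonglongrightarrow> 0" by simp
  qed simp
  ultimately show ?thesis by blast
qed

text \<open>The inequality for \<open>J\<close> is applied to near-minimising functions and to their
  derivatives with the same constant, and the results are added. The hypothesis bounds the midpoint
  class from below, hence also the subtracted sum of \<open>J\<close> at the midpoints.\<close>

lemma sobolev_uniformly_convex:
  assumes \<epsilon>: "\<epsilon> > 0"
  shows "\<exists>\<delta>>0. \<forall>U\<in>pts (S :: (real \<Rightarrow> 'c::euclidean_space) set nspace). \<forall>V\<in>pts S.
    vnorm S U \<le> 1 \<longrightarrow> vnorm S V \<le> 1 \<longrightarrow>
    vnorm S (vscale S (1 / 2) (vadd S U V)) > 1 - \<delta> \<longrightarrow> vnorm S (vdiff S U V) < \<epsilon>"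
proof -
  interpret real_nspace "S :: (real \<Rightarrow> 'c) set nspace" by (rule sobolev_real_nspace)
  \<comment> \<open>A quarter, because the final bound is \<open>2 * e\<close>: one \<open>e\<close>
    from the first term of the inequality, used with \<open>e / 2\<close> and two summands near 1,
    and one from \<open>C * (p * \<delta>)\<close>.\<close>
  define e where "e = \<epsilon> powr p / 4"
  have e: "e > 0" using \<epsilon> by (simp add: e_def)
  obtain C where C: "0 \<le> C" "\<And>u v :: real \<Rightarrow> 'c. u \<in> Lp \<Longrightarrow> v \<in> Lp \<Longrightarrow>
    J (\<lambda>t. u t + (- 1) *\<^sub>R v t) \<le> e / 2 * (J u + J v) +
      C * ((J u + J v) / 2 - J (\<lambda>t. (1 / 2) *\<^sub>R (u t + v t)))"
  proof (rule J_uniformly_convex[OF half_gt_zero[OF e], where ?'c = 'c])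
    fix C assume "0 \<le> C" "\<And>u v :: real \<Rightarrow> 'c. u \<in> Lp \<Longrightarrow> v \<in> Lp \<Longrightarrow>
      J (\<lambda>t. u t + (- 1) *\<^sub>R v t) \<le> e / 2 * (J u + J v) +
        C * ((J u + J v) / 2 - J (\<lambda>t. (1 / 2) *\<^sub>R (u t + v t)))"
    then show thesis by (rule that)
  qed
  \<comment> \<open>The bound 1 keeps \<open>1 - \<delta>\<close> nonnegative, so its p-th power is
    monotone; the added 1 in the denominator covers \<open>C = 0\<close>.\<close>
  define \<delta> where "\<delta> = min 1 (e / (C * p + 1))"
  have Cp: "C * p + 1 > 0" using C p by (simp add: add_nonneg_pos)
  have \<delta>: "0 < \<delta>" "\<delta> \<le> 1" using e Cp by (auto simp: \<delta>_def)
  have \<delta>_le: "C * (p * \<delta>) \<le> e"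
  proof -
    have "C * p * \<delta> \<le> (C * p + 1) * (e / (C * p + 1))"
      using C p \<delta> by (intro mult_mono) (auto simp: \<delta>_def)
    then show ?thesis using Cp by (simp add: mult.assoc)
  qed
  have "vnorm S (vdiff S U V) < \<epsilon>"
    if U: "U \<in> pts S" "vnorm S U \<le> 1" and V: "V \<in> pts S" "vnorm S V \<le> 1"
      and mid: "vnorm S (vscale S (1 / 2) (vadd S U V)) > 1 - \<delta>" for U V :: "(real \<Rightarrow> 'c) set"
  proof -
    have bound: "vnorm S (vdiff S U V) powr p \<le> e * r powr p + C * (r powr p - (1 - \<delta>) powr p)"
      if r: "r > 1" for r
    proof -
      obtain u g where u: "U = cls u" "u \<in> Lp" "weak u g" "J u + J g < r powr p"
        using vnorm_approx[OF U(1), of r] U(2) r by auto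
      obtain v h where v: "V = cls v" "v \<in> Lp" "weak v h" "J v + J h < r powr p"
        using vnorm_approx[OF V(1), of r] V(2) r by auto
      note gh = weak_Lp[OF u(3)] weak_Lp[OF v(3)]
      let ?m = "J (\<lambda>t. (1 / 2) *\<^sub>R (u t + v t)) + J (\<lambda>t. (1 / 2) *\<^sub>R (g t + h t))"
      have "(1 - \<delta>) powr p \<le> vnorm S (vscale S (1 / 2) (vadd S U V)) powr p"
        using mid \<delta> p by (intro powr_mono2) auto
      also have "vscale S (1 / 2) (vadd S U V) = cls (\<lambda>t. (1 / 2) *\<^sub>R (u t + v t))"
        using u v by (simp only: vadd_cls vscale_cls Lp_add)
      also have "vnorm S \<dots> powr p \<le> ?m"
        using u v by (intro vnorm_powr_le Lp_scale weak_scale Lp_add weak_add)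
      finally have m: "(1 - \<delta>) powr p \<le> ?m" .
      have "vnorm S (vdiff S U V) powr p \<le> J (\<lambda>t. u t + (- 1) *\<^sub>R v t) + J (\<lambda>t. g t + (- 1) *\<^sub>R h t)"
        unfolding u(1) v(1) vdiff_cls[OF u(2) v(2)] using u v
        by (intro vnorm_powr_le Lp_scale weak_scale Lp_add weak_add)
      also have "\<dots> \<le> (e / 2 * (J u + J v) + C * ((J u + J v) / 2 - J (\<lambda>t. (1 / 2) *\<^sub>R (u t + v t)))) +
          (e / 2 * (J g + J h) + C * ((J g + J h) / 2 - J (\<lambda>t. (1 / 2) *\<^sub>R (g t + h t))))"
        using u v gh by (intro add_mono C)
      also have "\<dots> = e / 2 * ((J u + J g) + (J v + J h)) + C * (((J u + J g) + (J v + J h)) / 2 - ?m)"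
        by (simp add: algebra_simps add_divide_distrib)
      also have "\<dots> \<le> e / 2 * (r powr p + r powr p) + C * ((r powr p + r powr p) / 2 - (1 - \<delta>) powr p)"
        using u v m e C(1) by (intro add_mono mult_left_mono diff_mono divide_right_mono) auto
      finally show ?thesis by simp
    qed
    have "(\<lambda>n. e * (1 + inverse (real (Suc n))) powr p +
          C * ((1 + inverse (real (Suc n))) powr p - (1 - \<delta>) powr p))
        \<longlonglongrightarrow> e * 1 powr p + C * (1 powr p - (1 - \<delta>) powr p)"
      by (intro tendsto_intros LIMSEQ_inverse_real_of_nat_add) auto
    then have "vnorm S (vdiff S U V) powr p \<le> e * 1 powr p + C * (1 powr p - (1 - \<delta>) powr p)"
      by (rule LIMSEQ_le_const) (auto intro!: exI[of _ 0] bound)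
    \<comment> \<open>The tangent at 1 gives
      \<open>1 - (1 - \<delta>) powr p \<le> p * \<delta>\<close>.\<close>
    also have "\<dots> \<le> e + C * (p * \<delta>)"
      using powr_ge_tangent(1)[OF p, of "1 - \<delta>" 1] \<delta> C(1) by (simp add: mult_left_mono)
    also have "\<dots> < \<epsilon> powr p" using \<delta>_le e unfolding e_def by linarith
    finally have less: "vnorm S (vdiff S U V) powr p < \<epsilon> powr p" .
    show ?thesis
    proof (rule ccontr)
      assume "\<not> ?thesis"
      then have "\<epsilon> powr p \<le> vnorm S (vdiff S U V) powr p"
        using p \<epsilon> by (intro powr_mono2) auto
      with less show False by simp
    qed
  qed
  note near = this
  show ?thesis
  proof (intro exI conjI ballI impI)
    show "0 < \<delta>" by (rule \<delta>)
  qed (rule near)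
qed

theorem sobolev_reflexive: "reflexive (S :: (real \<Rightarrow> 'c::euclidean_space) set nspace)"
proof -
  interpret real_nspace "S :: (real \<Rightarrow> 'c) set nspace" by (rule sobolev_real_nspace)
  show ?thesis
  proof (rule reflexive_if_uniformly_convex)
    fix U :: "nat \<Rightarrow> (real \<Rightarrow> 'c) set"
    assume "\<And>n. U n \<in> pts S" "\<And>n. vnorm S (vdiff S (U (Suc n)) (U n)) \<le> (1 / 2) ^ n"
    then show "\<exists>V\<in>pts S. (\<lambda>n. vnorm S (vdiff S (U n) V)) \<longlonglongrightarrow> 0" by (rule sobolev_complete)
  next
    fix \<epsilon> :: real assume "\<epsilon> > 0"
    then show "\<exists>\<delta>>0. \<forall>U\<in>pts (S :: (real \<Rightarrow> 'c) set nspace). \<forall>V\<in>pts S.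
      vnorm S U \<le> 1 \<longrightarrow> vnorm S V \<le> 1 \<longrightarrow>
      vnorm S (vscale S (1 / 2) (vadd S U V)) > 1 - \<delta> \<longrightarrow> vnorm S (vdiff S U V) < \<epsilon>"
      by (rule sobolev_uniformly_convex)
  qed
qed

text \<open>The hypothesis makes the Riemann--Liouville and the weak derivatives of each
  representative agree almost everywhere, so their \<open>J\<close> coincide and the sets under the
  two infima are equal. The relations themselves are not claimed to be equal.\<close>

lemma vnorm_RL:
  fixes U :: "(real \<Rightarrow> 'c::euclidean_space) set"
  assumes RL: "RL_deriv_is_weak_deriv T a b \<alpha> p TYPE('c)" and U: "U \<in> pts S"
  shows "vnorm (right_sobolev_space T a b \<alpha> p (RL_right_deriv T a b \<alpha> p)) U = vnorm S U"
proof -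
  obtain u0 g0 where u0: "U = cls u0" "u0 \<in> Lp" "weak u0 g0" using U by (rule ptsE)
  have ULp: "u \<in> Lp" and U_AE: "AE t in M. u t = u0 t" if "u \<in> U" for u
    using that by (simp_all add: u0(1) ae_class_def)
  have weak_ex: "weak u g0" if "u \<in> U" for u
    by (rule weak_cong[OF u0(3,2) ULp[OF that] U_AE[OF that] weak_Lp[OF u0(3)]]) simp
  have RL_ex: "\<exists>h. RL_right_deriv T a b \<alpha> p u h" if u: "u \<in> U" for u
    using RL[unfolded RL_deriv_is_weak_deriv_def, rule_format, OF ULp[OF u] weak_ex[OF u]] by blast
  have RL_J: "J h = J g" if u: "u \<in> U" and g: "weak u g" and h: "RL_right_deriv T a b \<alpha> p u h" for u g h
  proof (rule J_cong)
    show "h \<in> Lp" using h by (simp add: RL_right_deriv_def)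
    show "g \<in> Lp" using g by (rule weak_Lp)
    show "AE t in M. h t = g t"
      using RL[unfolded RL_deriv_is_weak_deriv_def, rule_format, OF ULp[OF u] g] h by blast
  qed
  have "{(J u + J g) powr (1 / p) | u g. u \<in> U \<and> RL_right_deriv T a b \<alpha> p u g} =
      {(J u + J g) powr (1 / p) | u g. u \<in> U \<and> weak u g}" (is "?A = ?B")
  proof (intro equalityI subsetI)
    fix x assume "x \<in> ?A"
    then obtain u h where uh: "x = (J u + J h) powr (1 / p)" "u \<in> U" "RL_right_deriv T a b \<alpha> p u h"
      by blast
    have "x = (J u + J g0) powr (1 / p)"
      unfolding uh(1) RL_J[OF uh(2) weak_ex[OF uh(2)] uh(3)] ..
    with uh(2) weak_ex[OF uh(2)] show "x \<in> ?B" by blast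
  next
    fix x assume "x \<in> ?B"
    then obtain u g where ug: "x = (J u + J g) powr (1 / p)" "u \<in> U" "weak u g" by blast
    obtain h where h: "RL_right_deriv T a b \<alpha> p u h" using RL_ex[OF ug(2)] ..
    have "x = (J u + J h) powr (1 / p)" unfolding ug(1) RL_J[OF ug(2,3) h] ..
    with ug(2) h show "x \<in> ?A" by blast
  qed
  then show ?thesis by (simp add: right_sobolev_space_def lp_norm_powr)
qed

theorem sobolev_RL_reflexive:
  assumes "RL_deriv_is_weak_deriv T a b \<alpha> p TYPE('c::euclidean_space)"
  shows "reflexive (right_sobolev_space T a b \<alpha> p (RL_right_deriv T a b \<alpha> p)
    :: (real \<Rightarrow> 'c) set nspace)"
  by (rule reflexive_cong[OF sobolev_reflexive])
    (auto simp: vnorm_RL[OF assms], auto simp: right_sobolev_space_def)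

end

theorem theorem4p7:
  fixes T :: "real set" and a b \<alpha> p :: real
  assumes "time_scale T" and "a \<in> T" and "b \<in> T" and "0 < a" and "a < b"
    and "0 < \<alpha>" and "\<alpha> \<le> 1" and "1 < p"
  shows "reflexive (right_sobolev_space T a b \<alpha> p (weak_right_deriv T a b \<alpha> p)
           :: (real \<Rightarrow> real ^ 'N) set nspace) \<and>
         (RL_deriv_is_weak_deriv T a b \<alpha> p TYPE(real ^ 'N) \<longrightarrow>
          reflexive (right_sobolev_space T a b \<alpha> p (RL_right_deriv T a b \<alpha> p)
           :: (real \<Rightarrow> real ^ 'N) set nspace))"
proof -
  interpret right_sobolev T a b p \<alpha>
    using assms by unfold_locales (auto simp: time_scale_def)
  show ?thesis by (simp add: sobolev_reflexive sobolev_RL_reflexive)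
qed

end
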